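(* Let $\omega \in H^{-1}_{\mathrm{loc}}(\mathbb{R}^2)\cap \mathcal{M}$ and $u = K\ast \omega$. If there exist constants $C>0$ and $\beta>1$ such that $$M_r(\omega) \le C |\log(r)|^{-\beta} \quad \text{for all } r\in(0,1/2),$$ then $$\frac{1}{|B_r(0)|}\int_{B_r(0)} \int_{\mathbb{R}^2} |u(x+h)-u(x)|^2\, dx \, dh \le \frac{C}{\beta-1} \Vert \omega \Vert_{\mathcal{M}} |\log(r)|^{1-\beta} \quad \text{for all } r\in(0,1/2).$$
   Context: $\mathcal{M}$ is the space of finite signed Radon measures on $\mathbb{R}^2$ with total variation norm $\Vert\cdot\Vert_{\mathcal{M}}$. The vorticity maximal function of $\omega\in\mathcal{M}$ is $M_r(\omega) := \sup_{x\in\mathbb{R}^2} |\omega|(\overline{B}_r(x))$, where $\overline{B}_r(x)$ is the closed ball of radius $r$ around $x$ and $|\omega|$ is the variation of $\omega$. The kernel is $K(x) = \frac{1}{2\pi}\frac{x^\perp}{|x|^2}$, $x^\perp = (-x_2,x_1)$, and $u(x) = (K\ast\omega)(x) = \int_{\mathbb{R}^2} K(x-y)\,d\omega(y)$ (defined for almost every $x$). *)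

theory Defs
  imports "HOL-Analysis.Analysis"
begin

section \<open>Finite signed measures\<close>

text \<open>A finite signed Borel measure is a real-valued, countably additive set function on the Borel
  sets; its values on other sets are irrelevant. On a Euclidean space every such measure is
  automatically Radon, so no regularity condition is imposed.\<close>

definition finite_signed_measure :: "('a::topological_space set \<Rightarrow> real) \<Rightarrow> bool" where
  "finite_signed_measure \<omega> \<longleftrightarrow> \<omega> {} = 0 \<and>
     (\<forall>A::nat \<Rightarrow> 'a set. range A \<subseteq> sets borel \<longrightarrow> disjoint_family A \<longrightarrow>
        (\<lambda>i. \<omega> (A i)) sums \<omega> (\<Union>i. A i))"

text \<open>The supremum runs over all countable Borel partitions of \<open>A\<close>.\<close>

definition variation :: "('a::topological_space set \<Rightarrow> real) \<Rightarrow> 'a set \<Rightarrow> ennreal" where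
  "variation \<omega> A =
     (SUP E \<in> {E :: nat \<Rightarrow> 'a set. range E \<subseteq> sets borel \<and> disjoint_family E \<and> (\<Union>i. E i) = A}.
        \<Sum>i. ennreal \<bar>\<omega> (E i)\<bar>)"

definition norm_M :: "('a::topological_space set \<Rightarrow> real) \<Rightarrow> ennreal" where
  "norm_M \<omega> = variation \<omega> UNIV"

text \<open>The Jordan decomposition of \<open>\<omega>\<close> consists of \<open>(\<bar>\<omega>\<bar> + \<omega>) / 2\<close> and \<open>(\<bar>\<omega>\<bar> - \<omega>) / 2\<close>. For a finite
  signed measure the variation is a finite measure, so that both set functions are finite measures
  and neither \<^const>\<open>enn2real\<close> nor \<^const>\<open>measure_of\<close> falls back on its default value.\<close>

definition pos_part :: "('a::topological_space set \<Rightarrow> real) \<Rightarrow> 'a measure" where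
  "pos_part \<omega> =
     measure_of UNIV (sets borel) (\<lambda>A. ennreal ((enn2real (variation \<omega> A) + \<omega> A) / 2))"

definition neg_part :: "('a::topological_space set \<Rightarrow> real) \<Rightarrow> 'a measure" where
  "neg_part \<omega> =
     measure_of UNIV (sets borel) (\<lambda>A. ennreal ((enn2real (variation \<omega> A) - \<omega> A) / 2))"

definition signed_integral ::
  "('a::topological_space set \<Rightarrow> real) \<Rightarrow> ('a \<Rightarrow> 'b::{banach, second_countable_topology}) \<Rightarrow> 'b" where
  "signed_integral \<omega> f = (\<integral>y. f y \<partial>pos_part \<omega>) - (\<integral>y. f y \<partial>neg_part \<omega>)"

section \<open>Test functions and negative Sobolev spaces\<close>

definition partial_deriv :: "'a::euclidean_space \<Rightarrow> ('a \<Rightarrow> real) \<Rightarrow> 'a \<Rightarrow> real" where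
  "partial_deriv b f x = frechet_derivative f (at x) b"

fun C_k :: "nat \<Rightarrow> ('a::euclidean_space \<Rightarrow> real) \<Rightarrow> bool" where
  "C_k 0 f \<longleftrightarrow> continuous_on UNIV f"
| "C_k (Suc k) f \<longleftrightarrow> (\<forall>x. f differentiable at x) \<and> (\<forall>b\<in>Basis. C_k k (partial_deriv b f))"

definition test_functions :: "('a::euclidean_space \<Rightarrow> real) set" where
  "test_functions = {\<phi>. (\<forall>k. C_k k \<phi>) \<and> compact (closure {x. \<phi> x \<noteq> 0})}"

definition H1_norm :: "('a::euclidean_space \<Rightarrow> real) \<Rightarrow> real" where
  "H1_norm \<psi> =
     sqrt ((\<integral>x. (\<psi> x)\<^sup>2 \<partial>lborel) + (\<integral>x. (\<Sum>b\<in>Basis. (partial_deriv b \<psi> x)\<^sup>2) \<partial>lborel))"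

text \<open>A distribution is represented by its values on test functions. It lies in \<open>H\<^sup>-\<^sup>1\<close>, the dual of
  \<open>H\<^sup>1\<close>, iff it is bounded with respect to the \<open>H\<^sup>1\<close> norm; the extension to \<open>H\<^sup>1\<close> is then unique, test
  functions being dense.\<close>

definition H_minus1 :: "(('a::euclidean_space \<Rightarrow> real) \<Rightarrow> real) \<Rightarrow> bool" where
  "H_minus1 T \<longleftrightarrow> (\<exists>c. \<forall>\<psi>\<in>test_functions. \<bar>T \<psi>\<bar> \<le> c * H1_norm \<psi>)"

text \<open>The product of a distribution \<open>T\<close> with a smooth function \<open>\<phi>\<close> maps \<open>\<psi>\<close> to \<open>T (\<phi> \<psi>)\<close>.\<close>

definition H_minus1_loc :: "(('a::euclidean_space \<Rightarrow> real) \<Rightarrow> real) \<Rightarrow> bool" where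
  "H_minus1_loc T \<longleftrightarrow> (\<forall>\<phi>\<in>test_functions. H_minus1 (\<lambda>\<psi>. T (\<lambda>x. \<phi> x * \<psi> x)))"

section \<open>Vorticity and velocity\<close>

definition vorticity_maximal :: "real \<Rightarrow> (('a::metric_space) set \<Rightarrow> real) \<Rightarrow> ennreal" where
  "vorticity_maximal r \<omega> = (SUP x. variation \<omega> (cball x r))"

definition perp :: "real^2 \<Rightarrow> real^2" where
  "perp x = vector [- x $ 2, x $ 1]"

definition biot_savart_kernel :: "real^2 \<Rightarrow> real^2" where
  "biot_savart_kernel x = (1 / (2 * pi)) *\<^sub>R (perp x /\<^sub>R (norm x)\<^sup>2)"

text \<open>The integral converges absolutely for almost every \<open>x\<close>; on the remaining null set the value is
  immaterial.\<close>

definition velocity :: "((real^2) set \<Rightarrow> real) \<Rightarrow> real^2 \<Rightarrow> real^2" where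
  "velocity \<omega> x = signed_integral \<omega> (\<lambda>y. biot_savart_kernel (x - y))"

end

theory Submission
  imports Defs "HOL-Complex_Analysis.Complex_Analysis"
begin

text \<open>Expanding the square, the average over \<open>\<bar>h\<bar> < r\<close> of \<open>\<parallel>u(\<cdot> + h) - u\<parallel>\<^sup>2\<close> is the double integral of
  \<open>A(y - y')\<close> with respect to \<open>\<omega> \<otimes> \<omega>\<close>, where \<open>A(z)\<close> is the average over \<open>h\<close> of
  \<open>\<integral> (K(x + h) - K(x)) \<bullet> (K(x + h - z) - K(x - z)) dx\<close>. By Newton's theorem for discs, averaging
  \<open>K(x + h)\<close> over \<open>h\<close> changes \<open>K\<close> only inside the disc of radius \<open>r\<close>, and the circulation of \<open>K\<close> along
  a circle not enclosing its singularity vanishes. Hence \<open>A\<close> vanishes outside the disc of radius \<open>r\<close>,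
  and inside it \<open>\<bar>A(z)\<bar> \<le> ln (r / \<bar>z\<bar>) / \<pi>\<close>. Finally
  \<open>\<integral>\<^bsub>\<bar>y - y'\<bar> < r\<^esub> ln (r / \<bar>y - y'\<bar>) d\<bar>\<omega>\<bar>(y') = \<integral>\<^sub>0\<^sup>r \<bar>\<omega>\<bar>(B\<^sub>s(y)) ds / s\<close>, and the decay of the
  vorticity maximal function bounds this by \<open>C \<bar>ln r\<bar>\<^sup>1\<^sup>-\<^sup>\<beta> / (\<beta> - 1)\<close>. After identifying the plane with
  the complex numbers, \<open>K\<close> becomes the complex conjugate of \<open>1 / z\<close>, up to the factor \<open>\<i> / (2 \<pi>)\<close>.\<close>

section \<open>Hahn and Jordan decomposition\<close>

text \<open>\<open>K\<close> is square integrable neither at its singularity nor at infinity, so the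
  terms of the expanded square cannot be integrated one by one. Fubini rests on absolute bounds for
  increments, where \<open>K (x + h) - K x\<close> decays like \<open>1 / |x|^2\<close>. These
  bounds carry a constant depending on \<open>r\<close> and only justify exchanging integrals; the
  sharp estimate takes absolute values after integrating over \<open>h\<close> and \<open>x\<close>,
  so that the rotational cancellation survives. The signed measure enters as its variation times a
  sign bounded by 1. On the diagonal the kernel bound is infinite, but the decay of the maximal
  function makes its integral over one point finite, uniformly in the other point; this is why the
  variation norm appears to the first power. The constants: with \<open>1 / z\<close> in place of
  \<open>K\<close> and without normalising the average, the energy kernel is at most
  \<open>4 * pi^2 * r^2 * ln (r / |z|)\<close>; passing to \<open>K\<close> contributes
  \<open>1 / (4 * pi^2)\<close> and the area of the disc \<open>1 / (pi * r^2)\<close>. This leaves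
  a spare factor \<open>1 / pi\<close>, so that the given \<open>C\<close> also serves in the
  conclusion.\<close>

lemma finite_signed_measure_Un:
  assumes "finite_signed_measure \<omega>" and AB: "A \<in> sets borel" "B \<in> sets borel" "A \<inter> B = {}"
  shows "\<omega> (A \<union> B) = \<omega> A + \<omega> B"
proof -
  have "(\<lambda>i. \<omega> (binaryset A B i)) sums \<omega> (\<Union>i. binaryset A B i)"
  proof -
    have "disjoint_family (binaryset A B)"
      using AB(3) unfolding disjoint_family_on_def binaryset_def by (simp add: Int_commute)
    moreover have "range (binaryset A B) \<subseteq> sets borel"
      using AB by (auto simp: range_binaryset_eq)
    ultimately show ?thesis
      using assms(1) unfolding finite_signed_measure_def by blast
  qed
  moreover have "(\<lambda>i. \<omega> (binaryset A B i)) sums (\<omega> A + \<omega> B)"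
    using assms(1) by (intro binaryset_sums) (simp add: finite_signed_measure_def)
  ultimately show ?thesis
    using sums_unique2 unfolding UN_binaryset_eq by blast
qed

lemma finite_signed_measure_Diff:
  assumes "finite_signed_measure \<omega>" "A \<in> sets borel" "B \<in> sets borel" "B \<subseteq> A"
  shows "\<omega> (A - B) = \<omega> A - \<omega> B"
proof -
  have "\<omega> ((A - B) \<union> B) = \<omega> (A - B) + \<omega> B"
    using assms by (intro finite_signed_measure_Un) auto
  then show ?thesis using assms(4) by (simp add: Un_absorb2)
qed

text \<open>Greedy exhaustion: keep removing from \<open>D\<close> a subset whose value is at least
  half of the largest available one. The removed sets are disjoint, so their values form a
  convergent series and tend to 0, which leaves no subset of positive value. As each removed value
  is nonnegative, the value of the remainder does not exceed \<open>\<omega> D\<close>.\<close>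

lemma signed_negative_subset:
  assumes fsm: "finite_signed_measure \<omega>" and D: "D \<in> sets borel"
  obtains A where "A \<in> sets borel" "A \<subseteq> D" "\<omega> A \<le> \<omega> D"
    "\<And>B. B \<in> sets borel \<Longrightarrow> B \<subseteq> A \<Longrightarrow> \<omega> B \<le> 0"
proof -
  have e0: "\<omega> {} = 0" using fsm by (simp add: finite_signed_measure_def)
  \<comment> \<open>The cap \<open>min 1\<close> replaces an upper bound for \<omega>, which is not
    yet available; the factor 2 leaves room for a supremum that is not attained.\<close>
  define good where "good = (\<lambda>X Y. X \<in> sets borel \<and> X \<subseteq> Y \<and> 0 \<le> \<omega> X \<and>
     (\<forall>B\<in>sets borel. B \<subseteq> Y \<longrightarrow> min 1 (\<omega> B) \<le> 2 * \<omega> X))"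
  have ex: "\<exists>X. good X Y" if Y: "Y \<in> sets borel" for Y
  proof -
    define S where "S = (\<lambda>B. min 1 (\<omega> B)) ` {B\<in>sets borel. B \<subseteq> Y}"
    have bdd: "bdd_above S" unfolding S_def by (rule bdd_aboveI2[of _ _ 1]) simp
    have "0 \<in> S" unfolding S_def using e0 by (intro image_eqI[of _ _ "{}"]) auto
    then have t0: "0 \<le> Sup S" using bdd cSup_upper by blast
    have le: "min 1 (\<omega> B) \<le> Sup S" if "B \<in> sets borel" "B \<subseteq> Y" for B
      using bdd that by (intro cSup_upper) (auto simp: S_def)
    show ?thesis
    proof (cases "Sup S = 0")
      case True
      then show ?thesis using le e0 unfolding good_def by (intro exI[of _ "{}"]) auto
    next
      case False
      then have "Sup S / 2 < Sup S" using t0 by simp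
      then obtain s where "s \<in> S" "Sup S / 2 < s"
        using less_cSup_iff[OF _ bdd] \<open>0 \<in> S\<close> by blast
      then obtain B where "B \<in> sets borel" "B \<subseteq> Y" "Sup S / 2 < min 1 (\<omega> B)"
        unfolding S_def by blast
      moreover have "min 1 (\<omega> B') \<le> 2 * \<omega> B" if "B' \<in> sets borel" "B' \<subseteq> Y" for B'
        using le[OF that] \<open>Sup S / 2 < min 1 (\<omega> B)\<close> by linarith
      moreover have "0 \<le> \<omega> B" using t0 \<open>Sup S / 2 < min 1 (\<omega> B)\<close> by linarith
      ultimately show ?thesis unfolding good_def by (intro exI[of _ B]) blast
    qed
  qed
  define f where "f Y = (SOME X. good X Y)" for Y
  have f: "good (f Y) Y" if "Y \<in> sets borel" for Y
    unfolding f_def using ex[OF that] by (rule someI_ex)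
  define An where "An n = ((\<lambda>Y. Y - f Y) ^^ n) D" for n
  have AS: "An (Suc n) = An n - f (An n)" for n by (simp add: An_def)
  have A0: "An 0 = D" by (simp add: An_def)
  have Ab: "An n \<in> sets borel" for n
  proof (induction n)
    case (Suc n)
    then show ?case using f[OF Suc] by (auto simp: AS good_def)
  qed (use D A0 in simp)
  have dec: "decseq An" by (rule decseq_SucI) (auto simp: AS)
  define Bn where "Bn n = f (An n)" for n
  have Bn: "good (Bn n) (An n)" for n using f[OF Ab] by (simp add: Bn_def)
  have Bb: "Bn n \<in> sets borel" and Bsub: "Bn n \<subseteq> An n" and B0: "0 \<le> \<omega> (Bn n)" for n
    using Bn[of n] by (auto simp: good_def)
  have disj: "Bn m \<inter> Bn n = {}" if "m < n" for m n
  proof -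
    have "Bn n \<subseteq> An (Suc m)" using Bsub[of n] decseqD[OF dec, of "Suc m" n] that by auto
    then show ?thesis by (auto simp: AS Bn_def)
  qed
  have dB: "disjoint_family Bn"
    unfolding disjoint_family_on_def
  proof (intro ballI impI)
    fix m n :: nat assume "m \<noteq> n"
    then show "Bn m \<inter> Bn n = {}" using disj[of m n] disj[of n m] by (cases m n rule: linorder_cases) blast+
  qed
  have sums: "(\<lambda>n. \<omega> (Bn n)) sums \<omega> (\<Union>n. Bn n)"
    using fsm dB Bb unfolding finite_signed_measure_def by (meson image_subsetI)
  define A where "A = D - (\<Union>n. Bn n)"
  have UB: "(\<Union>n. Bn n) \<subseteq> D" 
  proof (rule UN_least)
    show "Bn n \<subseteq> D" for n using Bsub[of n] decseqD[OF dec, of 0 n] A0 by simp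
  qed
  have AA: "A \<subseteq> An n" for n
    by (induction n) (auto simp: A0 AS A_def Bn_def)
  show ?thesis
  proof
    show "A \<in> sets borel" using D Bb by (auto simp: A_def)
    show "A \<subseteq> D" by (auto simp: A_def)
    have "0 \<le> \<omega> (\<Union>n. Bn n)" by (rule sums_le[OF _ sums_zero sums]) (rule B0)
    then show "\<omega> A \<le> \<omega> D"
      using finite_signed_measure_Diff[OF fsm D _ UB] Bb by (simp add: A_def)
    fix B :: "'a set" assume B: "B \<in> sets borel" "B \<subseteq> A"
    \<comment> \<open>A subset of the remainder was a candidate at every stage of the exhaustion, so
      its capped value is controlled by every removed value.\<close>
    have "min 1 (\<omega> B) \<le> 2 * \<omega> (Bn n)" for n
      using Bn[of n] B AA[of n] by (auto simp: good_def)
    moreover have "(\<lambda>n. 2 * \<omega> (Bn n)) \<longlonglongrightarrow> 2 * 0"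
      by (intro tendsto_intros summable_LIMSEQ_zero sums_summable[OF sums])
    ultimately have "min 1 (\<omega> B) \<le> 0"
      by (intro LIMSEQ_le_const[of "\<lambda>n. 2 * \<omega> (Bn n)"]) auto
    then show "\<omega> B \<le> 0" by (auto simp: min_def split: if_splits)
  qed
qed

text \<open>The complement of \<open>P\<close> is a negative set of least value, the union of a
  minimising sequence of negative sets. A set of negative value disjoint from it would contain, by
  \<open>signed_negative_subset\<close>, a negative set that could be adjoined to lower the value
  further.\<close>

lemma signed_Hahn_decomposition:
  fixes \<omega> :: "'a::topological_space set \<Rightarrow> real"
  assumes fsm: "finite_signed_measure \<omega>"
  obtains P where "P \<in> sets borel"
    "\<And>B. B \<in> sets borel \<Longrightarrow> B \<subseteq> P \<Longrightarrow> 0 \<le> \<omega> B"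
    "\<And>B. B \<in> sets borel \<Longrightarrow> B \<subseteq> - P \<Longrightarrow> \<omega> B \<le> 0"
proof -
  have e0: "\<omega> {} = 0" using fsm by (simp add: finite_signed_measure_def)
  define Neg where "Neg = {A \<in> sets borel. \<forall>B\<in>sets borel. B \<subseteq> A \<longrightarrow> \<omega> B \<le> 0}"
  have Neg_UN: "(\<Union>n. A n) \<in> Neg" if A: "\<And>n::nat. A n \<in> Neg" for A
  proof -
    have Ab: "\<And>n. A n \<in> sets borel" using A by (auto simp: Neg_def)
    have "\<omega> B \<le> 0" if B: "B \<in> sets borel" "B \<subseteq> (\<Union>n. A n)" for B
    proof -
      define E where "E n = B \<inter> disjointed A n" for n
      have Eb: "E n \<in> sets borel" for n
        using B sets.range_disjointed_sets[of A borel] Ab by (auto simp: E_def)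
      have "disjoint_family E" using disjoint_family_disjointed[of A]
        by (auto simp: disjoint_family_on_def E_def)
      moreover have "(\<Union>n. E n) = B" using B UN_disjointed_eq[of A] by (auto simp: E_def)
      ultimately have "(\<lambda>n. \<omega> (E n)) sums \<omega> B"
        using fsm Eb unfolding finite_signed_measure_def by blast
      moreover have "\<omega> (E n) \<le> 0" for n
        using A[of n] Eb[of n] disjointed_subset[of A n] by (auto simp: Neg_def E_def)
      ultimately show ?thesis using sums_le[of "\<lambda>n. \<omega> (E n)" "\<lambda>_. 0" "\<omega> B" 0] by simp
    qed
    then show ?thesis using Ab by (auto simp: Neg_def)
  qed
  have Neg_sub: "\<omega> A \<le> \<omega> A'" if "A \<in> Neg" "A' \<in> sets borel" "A' \<subseteq> A" for A A'
  proof -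
    have "\<omega> (A - A') \<le> 0" using that by (auto simp: Neg_def)
    then show ?thesis using finite_signed_measure_Diff[OF fsm _ that(2,3)] that(1) by (auto simp: Neg_def)
  qed
  \<comment> \<open>The infimum is taken in \<open>ereal\<close>, since boundedness from below
    follows only once \<open>N\<close> attains it.\<close>
  define S where "S = {ereal (\<omega> A) | A. A \<in> Neg}"
  have "{} \<in> Neg" using e0 by (auto simp: Neg_def)
  then have "S \<noteq> {}" by (auto simp: S_def)
  from Inf_countable_INF[OF this] obtain f :: "nat \<Rightarrow> ereal" where
    f: "range f \<subseteq> S" "Inf S = (INF i. f i)" by blast
  then have "\<forall>n. \<exists>A. A \<in> Neg \<and> f n = ereal (\<omega> A)" by (auto simp: S_def)
  then obtain A where A: "\<And>n. A n \<in> Neg" "\<And>n. f n = ereal (\<omega> (A n))" by metis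
  define N where "N = (\<Union>n. A n)"
  have N: "N \<in> Neg" unfolding N_def by (rule Neg_UN) (rule A)
  have "ereal (\<omega> N) \<le> f n" for n
    using Neg_sub[OF N, of "A n"] A by (auto simp: N_def Neg_def)
  then have "ereal (\<omega> N) \<le> Inf S" unfolding f(2) by (intro INF_greatest) auto
  then have min: "\<omega> N \<le> \<omega> A" if "A \<in> Neg" for A
  proof -
    have "Inf S \<le> ereal (\<omega> A)" using that by (intro Inf_lower) (auto simp: S_def)
    with \<open>ereal (\<omega> N) \<le> Inf S\<close> have "ereal (\<omega> N) \<le> ereal (\<omega> A)" by (rule order_trans)
    then show ?thesis by simp
  qed
  show ?thesis
  proof
    show "- N \<in> sets borel" using N by (auto simp: Neg_def)
    show "\<omega> B \<le> 0" if "B \<in> sets borel" "B \<subseteq> - (- N)" for B using N that by (auto simp: Neg_def)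
    fix B assume B: "B \<in> sets borel" "B \<subseteq> - N"
    show "0 \<le> \<omega> B"
    proof (rule ccontr)
      assume neg: "\<not> 0 \<le> \<omega> B"
      from signed_negative_subset[OF fsm B(1)] obtain E where
        E: "E \<in> sets borel" "E \<subseteq> B" "\<omega> E \<le> \<omega> B" "\<And>X. X \<in> sets borel \<Longrightarrow> X \<subseteq> E \<Longrightarrow> \<omega> X \<le> 0"
        by blast
      define F where "F = (\<lambda>n::nat. if n = 0 then N else E)"
      have "(\<Union>n. F n) \<in> Neg"
        by (rule Neg_UN) (use E N in \<open>auto simp: F_def Neg_def\<close>)
      moreover have "(\<Union>n. F n) = N \<union> E" by (auto simp: F_def split: if_splits)
      ultimately have "\<omega> N \<le> \<omega> (N \<union> E)" using min by metis
      also have "\<dots> = \<omega> N + \<omega> E"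
        using N E B by (intro finite_signed_measure_Un[OF fsm]) (auto simp: Neg_def)
      finally show False using E(3) neg by simp
    qed
  qed
qed

text \<open>For a Hahn set \<open>P\<close> the variation is
  \<open>V A = \<omega> (A \<inter> P) - \<omega> (A - P)\<close>. Expressing both Jordan parts
  through one measure turns integrals with respect to \<omega> into integrals of a sign against its
  variation.\<close>

lemma Jordan_decomposition:
  fixes \<omega> :: "'a::topological_space set \<Rightarrow> real"
  assumes fsm: "finite_signed_measure \<omega>"
  obtains \<nu> P where "finite_measure \<nu>" "sets \<nu> = sets borel" "P \<in> sets borel"
    "\<And>A. A \<in> sets borel \<Longrightarrow> emeasure \<nu> A = variation \<omega> A"
    "pos_part \<omega> = density \<nu> (indicator P)" "neg_part \<omega> = density \<nu> (indicator (- P))"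
proof -
  have e0: "\<omega> {} = 0" using fsm by (simp add: finite_signed_measure_def)
  obtain P where P: "P \<in> sets borel"
    and pos: "\<And>B. B \<in> sets borel \<Longrightarrow> B \<subseteq> P \<Longrightarrow> 0 \<le> \<omega> B"
    and neg: "\<And>B. B \<in> sets borel \<Longrightarrow> B \<subseteq> - P \<Longrightarrow> \<omega> B \<le> 0"
    using signed_Hahn_decomposition[OF fsm] by blast
  define V where "V A = \<omega> (A \<inter> P) - \<omega> (A - P)" for A
  have split: "\<omega> A = \<omega> (A \<inter> P) + \<omega> (A - P)" if "A \<in> sets borel" for A
    using finite_signed_measure_Un[OF fsm, of "A \<inter> P" "A - P"] that P
    by (simp add: Int_Diff_Un Int_Diff Int_Diff_disjoint)
  have pos': "0 \<le> \<omega> (A \<inter> P)" if "A \<in> sets borel" for A using pos that P by auto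
  have neg': "\<omega> (A - P) \<le> 0" if "A \<in> sets borel" for A
    using neg[of "A - P"] that P by (simp add: Diff_eq)
  have V0: "0 \<le> V A" if "A \<in> sets borel" for A using pos'[OF that] neg'[OF that] by (simp add: V_def)
  have absV: "\<bar>\<omega> A\<bar> \<le> V A" if "A \<in> sets borel" for A
    using pos'[OF that] neg'[OF that] split[OF that] by (simp add: V_def)
  have sumsV: "(\<lambda>i. V (E i)) sums V (\<Union>i. E i)"
    if E: "range E \<subseteq> sets borel" "disjoint_family E" for E :: "nat \<Rightarrow> 'a set"
  proof -
    have ca: "(\<lambda>i. \<omega> (F i)) sums \<omega> (\<Union>i. F i)"
      if "range F \<subseteq> sets borel" "disjoint_family F" for F :: "nat \<Rightarrow> 'a set"
      using fsm that unfolding finite_signed_measure_def by blast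
    have "(\<lambda>i. \<omega> (E i \<inter> P)) sums \<omega> (\<Union>i. E i \<inter> P)"
      using E P by (intro ca) (auto simp: disjoint_family_on_def)
    moreover have "(\<lambda>i. \<omega> (E i - P)) sums \<omega> (\<Union>i. E i - P)"
      using E P by (intro ca) (auto simp: disjoint_family_on_def)
    ultimately have "(\<lambda>i. V (E i)) sums (\<omega> (\<Union>i. E i \<inter> P) - \<omega> (\<Union>i. E i - P))"
      unfolding V_def by (rule sums_diff)
    moreover have "(\<Union>i. E i \<inter> P) = (\<Union>i. E i) \<inter> P" "(\<Union>i. E i - P) = (\<Union>i. E i) - P" by auto
    ultimately show ?thesis by (simp add: V_def)
  qed
  have sumV: "(\<Sum>i. ennreal (V (E i))) = ennreal (V (\<Union>i. E i))"
    if E: "range E \<subseteq> sets borel" "disjoint_family E" for E :: "nat \<Rightarrow> 'a set"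
    using sumsV[OF E] E(1) V0 by (intro suminf_ennreal_eq) auto
  have var: "variation \<omega> A = ennreal (V A)" if A: "A \<in> sets borel" for A
  proof (rule antisym)
    show "variation \<omega> A \<le> ennreal (V A)"
      unfolding variation_def
    proof (rule SUP_least, clarify)
      fix E :: "nat \<Rightarrow> 'a set" assume E: "range E \<subseteq> sets borel" "disjoint_family E"
      have "(\<Sum>i. ennreal \<bar>\<omega> (E i)\<bar>) \<le> (\<Sum>i. ennreal (V (E i)))"
        using E(1) by (intro suminf_le ennreal_leI absV) auto
      then show "(\<Sum>i. ennreal \<bar>\<omega> (E i)\<bar>) \<le> ennreal (V (\<Union>i. E i))" using sumV[OF E] by simp
    qed
    \<comment> \<open>Cutting \<open>A\<close> along the Hahn set already attains the supremum over
      all partitions.\<close>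
    define E where "E = binaryset (A \<inter> P) (A - P)"
    have Eb: "E i \<in> sets borel" for i using A P by (simp add: E_def binaryset_def)
    have "disjoint_family E" by (auto simp: E_def disjoint_family_on_def binaryset_def)
    moreover have "(\<Union>i. E i) = A" unfolding E_def UN_binaryset_eq by blast
    ultimately have "(\<Sum>i. ennreal \<bar>\<omega> (E i)\<bar>) \<le> variation \<omega> A"
      unfolding variation_def using Eb by (intro SUP_upper) auto
    moreover have "(\<Sum>i. ennreal \<bar>\<omega> (E i)\<bar>) = ennreal (V A)"
    proof -
      have "(\<lambda>i. \<bar>\<omega> (E i)\<bar>) sums (\<bar>\<omega> (A \<inter> P)\<bar> + \<bar>\<omega> (A - P)\<bar>)"
        unfolding E_def using e0 by (intro binaryset_sums[of "\<lambda>X. \<bar>\<omega> X\<bar>"]) simp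
      moreover have "\<bar>\<omega> (A \<inter> P)\<bar> + \<bar>\<omega> (A - P)\<bar> = V A"
        using pos'[OF A] neg'[OF A] by (simp add: V_def)
      ultimately show ?thesis by (intro suminf_ennreal_eq) auto
    qed
    ultimately show "ennreal (V A) \<le> variation \<omega> A" by simp
  qed
  define \<nu> where "\<nu> = measure_of UNIV (sets borel) (\<lambda>A. ennreal (V A))"
  have sets_\<nu>[simp]: "sets \<nu> = sets borel"
    unfolding \<nu>_def by (simp add: sets.sigma_sets_eq[of borel, simplified])
  have em: "emeasure \<nu> A = ennreal (V A)" if "A \<in> sets borel" for A
    unfolding \<nu>_def
  proof (rule emeasure_measure_of_sigma)
    show "sigma_algebra UNIV (sets (borel :: 'a measure))"
      using sets.sigma_algebra_axioms[of "borel :: 'a measure"] by simp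
    show "positive (sets (borel :: 'a measure)) (\<lambda>A. ennreal (V A))"
      by (simp add: positive_def V_def e0)
    show "countably_additive (sets (borel :: 'a measure)) (\<lambda>A. ennreal (V A))"
      unfolding countably_additive_def using sumV by blast
  qed fact
  \<comment> \<open>Both Jordan parts have this shape, because
    \<open>(V A + \<omega> A) / 2 = V (A \<inter> P)\<close>, while with a minus sign the portion of
    \<open>A\<close> outside \<open>P\<close> remains.\<close>
  have part: "measure_of UNIV (sets borel) f = density \<nu> (indicator Q)"
    if Q: "Q \<in> sets borel" and f: "\<And>A. A \<in> sets borel \<Longrightarrow> f A = ennreal (V (A \<inter> Q))" for f Q
  proof (rule measure_eqI)
    show sets_eq: "sets (measure_of UNIV (sets borel) f) = sets (density \<nu> (indicator Q))"
      by (simp add: sets.sigma_sets_eq[of borel, simplified])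
    have d: "emeasure (density \<nu> (indicator Q)) A = ennreal (V (A \<inter> Q))" if "A \<in> sets borel" for A
      using emeasure_restricted[of Q \<nu> A] that Q em[of "A \<inter> Q"] by (simp add: Int_commute)
    fix A assume "A \<in> sets (measure_of UNIV (sets borel) f)"
    then have A: "A \<in> sets borel" by (simp add: sets_eq)
    have "emeasure (measure_of UNIV (sets borel) f) A = f A"
    proof (rule emeasure_measure_of_sigma)
      show "sigma_algebra UNIV (sets (borel :: 'a measure))"
        using sets.sigma_algebra_axioms[of "borel :: 'a measure"] by simp
      show "positive (sets (borel :: 'a measure)) f"
        by (simp add: positive_def f V_def e0)
      show "countably_additive (sets (borel :: 'a measure)) f"
        unfolding countably_additive_def
      proof (intro allI impI)
        fix E :: "nat \<Rightarrow> 'a set" assume E: "range E \<subseteq> sets borel" "disjoint_family E" "\<Union> (range E) \<in> sets borel"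
        have "(\<Sum>i. f (E i)) = (\<Sum>i. ennreal (V (E i \<inter> Q)))" using E f by (intro suminf_cong) auto
        also have "\<dots> = ennreal (V (\<Union>i. E i \<inter> Q))"
          using E Q by (intro sumV) (auto simp: disjoint_family_on_def)
        also have "(\<Union>i. E i \<inter> Q) = (\<Union>i. E i) \<inter> Q" by auto
        finally show "(\<Sum>i. f (E i)) = f (\<Union> (range E))" using f[OF E(3)] by simp
      qed
    qed fact
    then show "emeasure (measure_of UNIV (sets borel) f) A = emeasure (density \<nu> (indicator Q)) A"
      using d[OF A] f[OF A] by simp
  qed
  show ?thesis
  proof (rule that[of \<nu> P])
    show "finite_measure \<nu>"
      using em[of UNIV] sets_eq_imp_space_eq[OF sets_\<nu>] by (intro finite_measureI) simp
    show "emeasure \<nu> A = variation \<omega> A" if "A \<in> sets borel" for A using em var that by simp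
    have half: "(enn2real (variation \<omega> A) + \<omega> A) / 2 = V (A \<inter> P)"
      "(enn2real (variation \<omega> A) - \<omega> A) / 2 = V (A \<inter> - P)" if A: "A \<in> sets borel" for A
    proof -
      have "\<omega> (A \<inter> P \<inter> P) = \<omega> (A \<inter> P)" "\<omega> (A \<inter> P - P) = 0"
        "\<omega> (A \<inter> - P \<inter> P) = 0" "\<omega> (A \<inter> - P - P) = \<omega> (A - P)"
        by (simp_all add: e0 Int_assoc Diff_eq)
      then show "(enn2real (variation \<omega> A) + \<omega> A) / 2 = V (A \<inter> P)"
        "(enn2real (variation \<omega> A) - \<omega> A) / 2 = V (A \<inter> - P)"
        unfolding V_def using var[OF A] V0[OF A] split[OF A] e0 by (simp_all only: V_def enn2real_ennreal) simp_all
    qed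
    show "pos_part \<omega> = density \<nu> (indicator P)"
      unfolding pos_part_def using half(1) P by (intro part) auto
    show "neg_part \<omega> = density \<nu> (indicator (- P))"
      unfolding neg_part_def using half(2) P by (intro part) auto
  qed (use P sets_\<nu> in auto)
qed

section \<open>Lebesgue measure on the complex plane\<close>

definition vec_complex :: "real^2 \<Rightarrow> complex" where
  "vec_complex v = Complex (v $ 1) (v $ 2)"

definition complex_vec :: "complex \<Rightarrow> real^2" where
  "complex_vec z = vector [Re z, Im z]"

lemma complex_vec_inverse [simp]: "vec_complex (complex_vec z) = z"
  by (simp add: vec_complex_def complex_vec_def)

lemma vec_complex_inverse [simp]: "complex_vec (vec_complex v) = v"
  by (simp add: vec_complex_def complex_vec_def vec_eq_iff forall_2)

lemma linear_vec_complex: "linear vec_complex"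
  by (rule linearI) (simp_all add: vec_complex_def complex_eq_iff)

lemma linear_complex_vec: "linear complex_vec"
  by (rule linearI) (simp_all add: complex_vec_def vec_eq_iff forall_2)

lemma norm_vec_complex [simp]: "norm (vec_complex v) = norm v"
  by (simp add: vec_complex_def norm_vec_def L2_set_def sum_2 cmod_def)

lemma norm_complex_vec [simp]: "norm (complex_vec z) = norm z"
  using norm_vec_complex[of "complex_vec z"] by simp

lemma vec_complex_diff: "vec_complex (v - w) = vec_complex v - vec_complex w"
  by (rule linear_diff[OF linear_vec_complex])

lemma vec_complex_add: "vec_complex (v + w) = vec_complex v + vec_complex w"
  by (rule linear_add[OF linear_vec_complex])

lemma measurable_vec_complex [measurable]: "vec_complex \<in> borel_measurable borel"
  by (intro borel_measurable_continuous_onI linear_continuous_on linear_linear[THEN iffD2, OF linear_vec_complex] linear_vec_complex linear_conv_bounded_linear[THEN iffD1])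

lemma measurable_complex_vec [measurable]: "complex_vec \<in> borel_measurable borel"
  by (intro borel_measurable_continuous_onI linear_continuous_on linear_complex_vec linear_conv_bounded_linear[THEN iffD1])

text \<open>Lebesgue measure is determined by its values on boxes, and the coordinate map carries
  boxes to boxes with the same side lengths.\<close>

lemma distr_vec_complex: "distr lborel borel vec_complex = lborel"
proof (rule lborel_eqI[symmetric])
  fix l u :: complex
  assume lu: "\<And>b. b \<in> Basis \<Longrightarrow> l \<bullet> b \<le> u \<bullet> b"
  have le: "Re l \<le> Re u" "Im l \<le> Im u"
    using lu[of 1] lu[of \<i>] by (simp_all add: Basis_complex_def inner_complex_def)
  have "vec_complex -` box l u = box (complex_vec l) (complex_vec u)"
    by (auto simp: mem_box_cart forall_2 vec_complex_def complex_vec_def in_box_complex_iff)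
  then have "emeasure (distr lborel borel vec_complex) (box l u)
    = emeasure lborel (box (complex_vec l) (complex_vec u))"
    by (simp add: emeasure_distr)
  also have "\<dots> = (\<Prod>b\<in>Basis. (complex_vec u - complex_vec l) \<bullet> b)"
    using le by (intro emeasure_lborel_box)
      (auto simp: Basis_vec_def UNIV_2 inner_axis complex_vec_def)
  also have "(\<Prod>b\<in>Basis. (complex_vec u - complex_vec l) \<bullet> b) = (Re u - Re l) * (Im u - Im l)"
    by (simp add: Basis_vec_def UNIV_2 axis_eq_axis inner_axis complex_vec_def)
  also have "\<dots> = (\<Prod>b\<in>Basis. (u - l) \<bullet> b)"
    by (simp add: Basis_complex_def inner_complex_def)
  finally show "emeasure (distr lborel borel vec_complex) (box l u) = (\<Prod>b\<in>Basis. (u - l) \<bullet> b)" .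
qed simp

text \<open>Rotation invariance is brought over from \<open>real^2\<close>, where Lebesgue measure
  is known to be invariant under orthogonal transformations.\<close>

lemma distr_cis_mult: "distr lborel borel ((*) (cis t)) = lborel"
proof (rule lborel_eqI[symmetric])
  fix l u :: complex
  assume lu: "\<And>b. b \<in> Basis \<Longrightarrow> l \<bullet> b \<le> u \<bullet> b"
  \<comment> \<open>The preimage under the rotation by \<open>t\<close> is the image under the
    inverse rotation, hence \<open>- t\<close>.\<close>
  define g where "g = complex_vec \<circ> (*) (cis (- t)) \<circ> vec_complex"
  have "linear g"
    unfolding g_def
    by (intro linear_compose linear_vec_complex linear_complex_vec bounded_linear.linear bounded_linear_mult_right)
  then have g: "orthogonal_transformation g"
    by (simp add: orthogonal_transformation g_def norm_mult)
  define S where "S = vec_complex -` box l u"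
  have S: "S = box (complex_vec l) (complex_vec u)"
    by (auto simp: S_def mem_box_cart forall_2 vec_complex_def complex_vec_def in_box_complex_iff)
  have [measurable]: "(*) (cis t) \<in> borel_measurable borel" by simp
  have gS: "vec_complex -` ((*) (cis t) -` box l u) = g ` S"
  proof (intro subset_antisym subsetI)
    fix v assume "v \<in> vec_complex -` ((*) (cis t) -` box l u)"
    then have "cis t * vec_complex v \<in> box l u" by simp
    then have "complex_vec (cis t * vec_complex v) \<in> S" by (simp add: S_def)
    moreover have "g (complex_vec (cis t * vec_complex v)) = v"
      by (simp add: g_def mult.assoc[symmetric] cis_mult)
    ultimately show "v \<in> g ` S" by (metis image_eqI)
  next
    fix w assume "w \<in> g ` S"
    then obtain v where "v \<in> S" "w = g v" by blast
    then show "w \<in> vec_complex -` ((*) (cis t) -` box l u)"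
      by (simp add: g_def S_def mult.assoc[symmetric] cis_mult)
  qed
  have SL: "S \<in> lmeasurable" by (simp add: S)
  have gB: "g ` S \<in> sets borel"
    unfolding gS[symmetric]
    by (intro measurable_sets_borel[OF measurable_vec_complex] measurable_sets_borel[of "(*) (cis t)" borel]) simp_all
  have "emeasure (distr lborel borel ((*) (cis t))) (box l u) = emeasure lborel ((*) (cis t) -` box l u)"
    by (simp add: emeasure_distr)
  also have "\<dots> = emeasure (distr lborel borel vec_complex) ((*) (cis t) -` box l u)"
    by (simp add: distr_vec_complex)
  also have "\<dots> = emeasure lborel (g ` S)"
    by (subst emeasure_distr) (simp_all add: gS measurable_sets_borel[of "(*) (cis t)" borel])
  also have "\<dots> = emeasure lebesgue (g ` S)" using gB by simp
  also have "\<dots> = ennreal (measure lebesgue (g ` S))"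
    using measurable_orthogonal_image[OF g SL] by (simp add: emeasure_eq_measure2)
  also have "measure lebesgue (g ` S) = measure lebesgue S"
    by (rule measure_orthogonal_image[OF g SL])
  also have "ennreal (measure lebesgue S) = emeasure lborel S"
    using SL by (simp add: emeasure_eq_measure2[symmetric] S)
  also have "\<dots> = emeasure (distr lborel borel vec_complex) (box l u)"
    by (simp add: emeasure_distr S_def)
  also have "\<dots> = (\<Prod>b\<in>Basis. (u - l) \<bullet> b)"
    unfolding distr_vec_complex by (rule emeasure_lborel_box[OF lu])
  finally show "emeasure (distr lborel borel ((*) (cis t))) (box l u) = (\<Prod>b\<in>Basis. (u - l) \<bullet> b)" .
qed simp

lemma distr_uminus_complex: "distr lborel borel (\<lambda>x::complex. - x) = lborel"
proof -
  have "(\<lambda>x. - x) = (*) (cis pi)" by (simp add: fun_eq_iff)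
  then show ?thesis by (simp only: distr_cis_mult)
qed

text \<open>Polar coordinates without the angle: a disc of radius \<open>a\<close> has area
  \<open>pi * a^2\<close>, whose derivative is the density \<open>2 * pi * s\<close>. The half-lines
  \<open>{..<a}\<close> generate the Borel sets, and \<open>max 0 a\<close> covers negative
  \<open>a\<close>.\<close>

lemma distr_norm_complex:
  "distr (lborel :: complex measure) borel norm
     = density lborel (\<lambda>s. indicator {0<..} s * ennreal (2 * pi * s))" (is "?M = ?N")
proof (rule measure_eqI_generator_eq[of "range lessThan" UNIV _ _ "\<lambda>n. {..<real n}"])
  show "Int_stable (range (lessThan :: real \<Rightarrow> _))"
    unfolding Int_stable_def
  proof safe
    show "{..<a} \<inter> {..<b} \<in> range lessThan" for a b :: real by (rule image_eqI[of _ _ "min a b"]) auto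
  qed
  have eq: "emeasure ?M {..<a} = ennreal (pi * (max 0 a)\<^sup>2)" "emeasure ?N {..<a} = ennreal (pi * (max 0 a)\<^sup>2)" for a
  proof -
    have "norm -` {..<a} = ball (0::complex) (max 0 a)" by (auto simp: max_def) (meson norm_ge_zero order_le_less_trans less_imp_le)+
    then show "emeasure ?M {..<a} = ennreal (pi * (max 0 a)\<^sup>2)"
      by (simp add: emeasure_distr emeasure_ball unit_ball_vol_2)
    have "emeasure ?N {..<a} = (\<integral>\<^sup>+s. ennreal (2 * pi * s) * indicator {0..max 0 a} s \<partial>lborel)"
    \<comment> \<open>The two integrands may differ at \<open>s = a\<close>, because the fundamental
      theorem is applied on a closed interval.\<close>
    proof (subst emeasure_density)
      have "indicator {0<..} s * ennreal (2 * pi * s) * indicator {..<a} s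
          = ennreal (2 * pi * s) * indicator {0..max 0 a} s" if "s \<noteq> a" for s
        using that by (cases "s = 0"; cases "s < 0"; cases "s < a") (auto simp: indicator_def max_def)
      then show "(\<integral>\<^sup>+s. indicator {0<..} s * ennreal (2 * pi * s) * indicator {..<a} s \<partial>lborel)
          = (\<integral>\<^sup>+s. ennreal (2 * pi * s) * indicator {0..max 0 a} s \<partial>lborel)"
        using AE_lborel_singleton[of a] by (intro nn_integral_cong_AE) (auto elim!: eventually_mono)
    qed auto
    also have "\<dots> = ennreal (pi * (max 0 a)\<^sup>2 - pi * 0\<^sup>2)"
      by (rule nn_integral_FTC_Icc) (auto intro!: derivative_eq_intros)
    finally show "emeasure ?N {..<a} = ennreal (pi * (max 0 a)\<^sup>2)" by simp
  qed
  show "emeasure ?M X = emeasure ?N X" if "X \<in> range lessThan" for X using that eq by auto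
  show "emeasure ?M {..<real n} \<noteq> \<infinity>" for n by (simp add: eq)
  show "(\<Union>n. {..<real n}) = UNIV" using reals_Archimedean2 by auto
  show "sets ?M = sigma_sets UNIV (range lessThan)" "sets ?N = sigma_sets UNIV (range lessThan)"
    by (simp_all add: borel_Iio)
qed auto

lemma nn_integral_radial:
  assumes [measurable]: "\<phi> \<in> borel_measurable borel"
  shows "(\<integral>\<^sup>+x. \<phi> (norm (x::complex)) \<partial>lborel)
    = (\<integral>\<^sup>+s. indicator {0<..} s * ennreal (2 * pi * s) * \<phi> s \<partial>lborel)"
proof -
  have "(\<integral>\<^sup>+x. \<phi> (norm (x::complex)) \<partial>lborel) = (\<integral>\<^sup>+s. \<phi> s \<partial>distr (lborel :: complex measure) borel norm)"
    by (simp add: nn_integral_distr)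
  then show ?thesis by (simp add: distr_norm_complex nn_integral_density)
qed

section \<open>Circle averages of the kernel\<close>

text \<open>With \<open>v = cis t\<close>, the partial fractions
  \<open>1 / (v * (z - v * w)) = (1 / v - 1 / (v - z / w)) / z\<close> reduce the integral to two
  winding numbers: that of 0 is 1, that of \<open>z / w\<close> is 1 exactly when
  \<open>z / w\<close> lies inside the unit circle. The hypothesis keeps the pole off the circle of
  integration.\<close>

lemma circle_integral_inverse:
  fixes z w :: complex
  assumes "norm w \<noteq> norm z"
  shows "((\<lambda>t. 1 / (z - cis t * w)) has_integral (if norm w < norm z then 2 * pi / z else 0)) {0..2*pi}"
proof -
  define g where "g = circlepath 0 1"
  have g: "valid_path g" "pathfinish g = pathstart g" "path_image g = sphere 0 1" 
    by (simp_all add: g_def)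
  text \<open>On the unit circle \<open>dv / (i v) = dt\<close>.\<close>
  have eq: "((\<lambda>v. 1 / (v * (z - v * w))) has_contour_integral (if norm w < norm z then 2 * pi * \<i> / z else 0)) g"
  proof (cases "w = 0")
    case True
    have "((\<lambda>v. 1 / z * (1 / (v - 0))) has_contour_integral (1 / z * (2 * pi * \<i> * winding_number g 0))) g"
      using g by (intro has_contour_integral_lmul has_contour_integral_winding_number) auto
    moreover have "winding_number g 0 = 1" by (simp add: g_def winding_number_circlepath_centre)
    ultimately show ?thesis using True assms by (simp add: mult_ac)
  next
    case w: False
    show ?thesis
    proof (cases "z = 0")
      \<comment> \<open>The partial fractions degenerate to a double pole at 0; it has a primitive,
        so the integral over the closed circle vanishes.\<close>
      case True
      have "((\<lambda>v. - (1 / w) * (1 / v ^ 2)) has_contour_integral 0) g"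
      proof -
        have "((\<lambda>v. 1 / v\<^sup>2) has_contour_integral (- inverse (pathfinish g) - - inverse (pathstart g))) g"
          using g by (intro contour_integral_primitive[where S="-{0}"])
            (auto intro!: derivative_eq_intros simp: power2_eq_square field_simps)
        then show ?thesis using g(2) has_contour_integral_lmul[of "\<lambda>v. 1 / v\<^sup>2" 0 g "- (1/w)"] by simp
      qed
      then show ?thesis using True w by (simp add: power2_eq_square mult_ac)
    next
      case z: False
      have n: "norm (z / w) \<noteq> 1" using assms w by (auto simp: norm_divide field_simps)
      have "((\<lambda>v. 1 / z * (1 / (v - 0)) - 1 / z * (1 / (v - z / w))) has_contour_integral
         (1 / z * (2 * pi * \<i> * winding_number g 0) - 1 / z * (2 * pi * \<i> * winding_number g (z / w)))) g"
        using g n by (intro has_contour_integral_lmul has_contour_integral_diff has_contour_integral_winding_number) auto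
      moreover have "winding_number g 0 = 1" by (simp add: g_def winding_number_circlepath_centre)
      moreover have "winding_number g (z / w) = (if norm w < norm z then 0 else 1)"
      proof (cases "norm w < norm z")
        case True
        then have "1 < norm (z / w)" using w by (simp add: norm_divide field_simps)
        then have "winding_number g (z / w) = 0"
          using g by (intro winding_number_zero_outside[of g "cball 0 1"]) (auto simp: valid_path_imp_path)
        then show ?thesis using True by simp
      next
        case False
        then have "norm (z / w) < 1" using w assms by (simp add: norm_divide field_simps)
        then show ?thesis using False by (simp add: g_def winding_number_circlepath)
      qed
      ultimately have "((\<lambda>v. 1 / z * (1 / (v - 0)) - 1 / z * (1 / (v - z / w))) has_contour_integral
         (if norm w < norm z then 2 * pi * \<i> / z else 0)) g"
        by (simp split: if_splits)
      then show ?thesis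
      proof (rule has_contour_integral_eq)
        fix v assume "v \<in> path_image g"
        then have v: "norm v = 1" using g by simp
        then have "v \<noteq> 0" "v * w \<noteq> z" using assms by (auto simp: norm_mult)
        then have "v - z / w \<noteq> 0" "z - v * w \<noteq> 0" using w by (auto simp: field_simps)
        then show "1 / z * (1 / (v - 0)) - 1 / z * (1 / (v - z / w)) = 1 / (v * (z - v * w))"
          using z w \<open>v \<noteq> 0\<close> by (simp add: divide_simps)
      qed
    qed
  qed
  have "((\<lambda>x. vector_derivative g (at x) * (1 / (g x * (z - g x * w)))) has_integral 
     (if norm w < norm z then 2 * pi * \<i> / z else 0)) {0..1}"
    using eq by (simp add: has_contour_integral mult.commute)
  then have "((\<lambda>x. 2 * pi * \<i> * (1 / (z - cis (2 * pi * x) * w))) has_integral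
     (if norm w < norm z then 2 * pi * \<i> / z else 0)) {0..1}"
  proof (rule has_integral_eq[rotated])
    have "vector_derivative g (at x) = 2 * pi * \<i> * cis (2 * pi * x)" "g x = cis (2 * pi * x)" for x
      unfolding g_def vector_derivative_circlepath by (simp_all add: circlepath cis_conv_exp mult_ac)
    then show "vector_derivative g (at x) * (1 / (g x * (z - g x * w))) = 2 * pi * \<i> * (1 / (z - cis (2 * pi * x) * w))" for x
      by simp
  qed
  then have "((\<lambda>x. 1 / (2 * pi * \<i>) * (2 * pi * \<i> * (1 / (z - cis (2 * pi * x) * w)))) has_integral
     1 / (2 * pi * \<i>) * (if norm w < norm z then 2 * pi * \<i> / z else 0)) {0..1}"
    by (rule has_integral_mult_right)
  then have "((\<lambda>x. 1 / (z - cis (2 * pi * x) * w)) has_integral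
     (if norm w < norm z then 1 / z else 0)) {0..1}"
    by (simp split: if_splits)
  from has_integral_affinity'[OF this[folded cbox_interval], of "1 / (2 * pi)" 0]
  show ?thesis
    by (simp add: scaleR_conv_of_real split: if_splits)
qed

section \<open>Absolute bounds for kernel products\<close>

lemma pred_in_ball [measurable (raw)]:
  fixes f :: "'a \<Rightarrow> 'b::{metric_space, second_countable_topology}"
  assumes [measurable]: "f \<in> borel_measurable M"
  shows "Measurable.pred M (\<lambda>x. f x \<in> ball c \<rho>)"
  unfolding mem_ball by measurable

section \<open>Integrals of inverse powers of the norm and their translates\<close>

lemma nn_integral_lborel_shift:
  fixes c :: "'a::euclidean_space"
  assumes [measurable]: "f \<in> borel_measurable borel"
  shows "(\<integral>\<^sup>+x. f (x + c) \<partial>lborel) = (\<integral>\<^sup>+x. f x \<partial>lborel)"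
proof -
  have "(\<integral>\<^sup>+x. f x \<partial>lborel) = (\<integral>\<^sup>+x. f x \<partial>distr lborel borel ((+) c))"
    by (simp add: lborel_distr_plus)
  also have "\<dots> = (\<integral>\<^sup>+x. f (x + c) \<partial>lborel)"
    by (subst nn_integral_distr) (simp_all add: add.commute)
  finally show ?thesis by simp
qed

lemma nn_integral_lborel_shift_diff:
  fixes c :: "'a::euclidean_space"
  assumes [measurable]: "f \<in> borel_measurable borel"
  shows "(\<integral>\<^sup>+x. f (x - c) \<partial>lborel) = (\<integral>\<^sup>+x. f x \<partial>lborel)"
  using nn_integral_lborel_shift[OF assms, of "- c"] by simp

text \<open>This is \<open>ln (r / a)\<close> for \<open>0 < a < r\<close> and, unlike that expression, infinite for \<open>a = 0\<close>.\<close>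

definition log_kernel :: "real \<Rightarrow> real \<Rightarrow> ennreal" where
  "log_kernel r a = (\<integral>\<^sup>+s. indicator {a<..<r} s * ennreal (1 / s) \<partial>lborel)"

lemma log_kernel_finite:
  assumes "0 < a"
  shows "log_kernel r a < \<infinity>"
proof -
  have "log_kernel r a \<le> (\<integral>\<^sup>+s. ennreal (1 / a) * indicator {a<..<r} s \<partial>lborel)"
    unfolding log_kernel_def using assms
    by (intro nn_integral_mono) (auto split: split_indicator intro!: ennreal_leI divide_left_mono)
  also have "\<dots> < \<infinity>"
    by (cases "a \<le> r") (simp_all add: nn_integral_cmult_indicator ennreal_mult_less_top)
  finally show ?thesis .
qed

text \<open>The polar weight turns \<open>1 / s^2\<close> into \<open>1 / s\<close>, the integrand
  of \<open>log_kernel\<close>.\<close>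

lemma nn_integral_norm_power_annulus:
  "(\<integral>\<^sup>+x. indicator {a<..<r} (norm x) * ennreal (1 / (norm (x::complex))\<^sup>2) \<partial>lborel)
     \<le> ennreal (2 * pi) * log_kernel r a"
proof -
  have "(\<integral>\<^sup>+x. indicator {a<..<r} (norm x) * ennreal (1 / (norm (x::complex))\<^sup>2) \<partial>lborel)
      = (\<integral>\<^sup>+s. indicator {0<..} s * ennreal (2 * pi * s) * (indicator {a<..<r} s * ennreal (1 / s\<^sup>2)) \<partial>lborel)"
    by (rule nn_integral_radial) measurable
  also have "\<dots> \<le> (\<integral>\<^sup>+s. ennreal (2 * pi) * (indicator {a<..<r} s * ennreal (1 / s)) \<partial>lborel)"
    by (intro nn_integral_mono)
      (auto split: split_indicator simp: ennreal_mult[symmetric] power2_eq_square)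
  also have "\<dots> = ennreal (2 * pi) * log_kernel r a"
    unfolding log_kernel_def by (rule nn_integral_cmult) measurable
  finally show ?thesis .
qed

lemma nn_integral_inverse_norm_ball:
  assumes "0 \<le> \<rho>"
  shows "(\<integral>\<^sup>+x. indicator (ball 0 \<rho>) x * ennreal (1 / norm (x::complex)) \<partial>lborel) \<le> ennreal (2 * pi * \<rho>)"
proof -
  have "(\<integral>\<^sup>+x. indicator (ball 0 \<rho>) x * ennreal (1 / norm (x::complex)) \<partial>lborel)
      = (\<integral>\<^sup>+x. indicator {..<\<rho>} (norm x) * ennreal (1 / norm (x::complex)) \<partial>lborel)"
    by (intro nn_integral_cong) (auto split: split_indicator)
  also have "\<dots> = (\<integral>\<^sup>+s. indicator {0<..} s * ennreal (2 * pi * s) * (indicator {..<\<rho>} s * ennreal (1 / s)) \<partial>lborel)"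
    by (rule nn_integral_radial) measurable
  also have "\<dots> \<le> (\<integral>\<^sup>+s. ennreal (2 * pi) * indicator {0<..<\<rho>} s \<partial>lborel)"
    by (intro nn_integral_mono) (auto split: split_indicator simp: ennreal_mult[symmetric])
  also have "\<dots> = ennreal (2 * pi * \<rho>)"
    using assms by (simp add: nn_integral_cmult_indicator ennreal_mult)
  finally show ?thesis .
qed

text \<open>What matters is uniformity in \<open>z\<close>: within distance 1 of \<open>z\<close>
  the singularity integrates to at most \<open>2 * pi\<close>, and farther away the integrand is at
  most 1, which costs the area of the ball.\<close>

lemma nn_integral_inverse_norm_shifted_ball:
  assumes "0 \<le> \<rho>"
  shows "(\<integral>\<^sup>+x. indicator (ball 0 \<rho>) x * ennreal (1 / norm (x - z :: complex)) \<partial>lborel)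
     \<le> ennreal (2 * pi + pi * \<rho>\<^sup>2)"
proof -
  have "(\<integral>\<^sup>+x. indicator (ball 0 \<rho>) x * ennreal (1 / norm (x - z)) \<partial>lborel)
     \<le> (\<integral>\<^sup>+x. indicator (ball 0 1) (x - z) * ennreal (1 / norm (x - z)) + indicator (ball 0 \<rho>) x \<partial>lborel)"
  proof (intro nn_integral_mono)
    fix x
    show "indicator (ball 0 \<rho>) x * ennreal (1 / norm (x - z))
      \<le> indicator (ball 0 1) (x - z) * ennreal (1 / norm (x - z)) + indicator (ball 0 \<rho>) x"
    proof (cases "norm (x - z) < 1")
      case False
      then have "ennreal (1 / norm (x - z)) \<le> ennreal 1" by (intro ennreal_leI) (auto simp: divide_le_eq)
      then show ?thesis using False by (auto split: split_indicator)
    qed (auto split: split_indicator)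
  qed
  also have "\<dots> = (\<integral>\<^sup>+x. indicator (ball 0 1) (x - z) * ennreal (1 / norm (x - z)) \<partial>lborel)
     + (\<integral>\<^sup>+x. indicator (ball (0::complex) \<rho>) x \<partial>lborel)"
    by (rule nn_integral_add) measurable
  also have "(\<integral>\<^sup>+x. indicator (ball (0::complex) \<rho>) x \<partial>lborel) = emeasure lborel (ball (0::complex) \<rho>)"
    by simp
  also have "(\<integral>\<^sup>+x. indicator (ball 0 1) (x - z) * ennreal (1 / norm (x - z)) \<partial>lborel)
      = (\<integral>\<^sup>+x. indicator (ball 0 1) x * ennreal (1 / norm (x::complex)) \<partial>lborel)"
    by (rule nn_integral_lborel_shift_diff) measurable
  also have "\<dots> \<le> ennreal (2 * pi)" using nn_integral_inverse_norm_ball[of 1] by simp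
  also have "emeasure lborel (ball (0::complex) \<rho>) = ennreal (pi * \<rho>\<^sup>2)"
    using assms by (simp add: emeasure_ball unit_ball_vol_2)
  finally show ?thesis by (simp add: ennreal_plus[symmetric] add_right_mono del: ennreal_plus)
qed

lemma nn_integral_inverse_norm_cube:
  assumes "0 < \<rho>"
  shows "(\<integral>\<^sup>+x. indicator {\<rho>..} (norm x) * ennreal (1 / (norm (x::complex))^3) \<partial>lborel) \<le> ennreal (2 * pi / \<rho>)"
proof -
  have "(\<integral>\<^sup>+x. indicator {\<rho>..} (norm x) * ennreal (1 / (norm (x::complex))^3) \<partial>lborel)
      = (\<integral>\<^sup>+s. indicator {0<..} s * ennreal (2 * pi * s) * (indicator {\<rho>..} s * ennreal (1 / s^3)) \<partial>lborel)"
    by (rule nn_integral_radial) measurable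
  also have "\<dots> \<le> (\<integral>\<^sup>+s. ennreal (2 * pi / s\<^sup>2) * indicator {\<rho>..} s \<partial>lborel)"
    by (intro nn_integral_mono)
      (auto split: split_indicator simp: ennreal_mult[symmetric] power2_eq_square power3_eq_cube)
  also have "\<dots> = ennreal (0 - (- 2 * pi / \<rho>))"
  proof (rule nn_integral_FTC_atLeast)
    show "((\<lambda>s. - 2 * pi / s) \<longlongrightarrow> 0) at_top"
      by (intro tendsto_divide_0[OF tendsto_const] filterlim_at_top_imp_at_infinity filterlim_ident)
    show "((\<lambda>s. - 2 * pi / s) has_real_derivative 2 * pi / s\<^sup>2) (at s)" if "\<rho> \<le> s" for s
      using that assms by (auto intro!: derivative_eq_intros simp: power2_eq_square)
  qed auto
  finally show ?thesis by simp
qed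

text \<open>The singularity as \<open>z\<close> tends to 0 is only logarithmic. In the smaller
  distance \<open>s\<close> the integrand is at most \<open>1 / (s * max s (norm z / 2))\<close>,
  and the polar weight \<open>2 * pi * s\<close> cancels one power; the ranges
  \<open>s \<le> norm z\<close>, \<open>norm z < s < r\<close> and \<open>s \<ge> r\<close>
  contribute 2, the logarithm and \<open>\<rho> / r\<close>. Either pole may be the closer one,
  which doubles \<open>2 * pi\<close>.\<close>

lemma nn_integral_inverse_norm_product:
  assumes "0 < r" "0 < \<rho>"
  shows "(\<integral>\<^sup>+x. indicator (ball 0 \<rho>) x * ennreal (1 / norm x) * ennreal (1 / norm (x - z :: complex)) \<partial>lborel)
     \<le> ennreal (4 * pi) * (log_kernel r (norm z) + ennreal (\<rho> / r + 2))"
proof -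
  define a where "a = norm z"
  have a: "0 \<le> a" by (simp add: a_def)
  \<comment> \<open>An upper bound in the smaller distance \<open>s\<close>: the larger one is at
    least \<open>s\<close>, and at least \<open>a / 2\<close> by the triangle inequality.\<close>
  define m where "m s = indicator {..<\<rho>} s * ennreal (1 / (s * max s (a / 2)))" for s
  have [measurable]: "m \<in> borel_measurable borel" unfolding m_def by measurable
  have le: "1 / (u * v) \<le> 1 / (u * max u (a / 2))" if "0 < u" "max u (a / 2) \<le> v" for u v
    using that by (intro divide_left_mono mult_left_mono mult_pos_pos) (auto simp: less_max_iff_disj)
  have "indicator (ball 0 \<rho>) x * ennreal (1 / norm x) * ennreal (1 / norm (x - z)) \<le> m (norm x) + m (norm (x - z))" for x
  proof (cases "x \<in> ball 0 \<rho> \<and> x \<noteq> 0 \<and> x \<noteq> z")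
    case True
    have tri: "a \<le> norm x + norm (x - z)"
      using norm_triangle_ineq4[of x "x - z"] by (simp add: a_def)
    have eq: "indicator (ball 0 \<rho>) x * ennreal (1 / norm x) * ennreal (1 / norm (x - z)) = ennreal (1 / (norm x * norm (x - z)))"
      using True by (simp add: ennreal_mult[symmetric])
    show ?thesis
    proof (cases "norm x \<le> norm (x - z)")
      case True': True
      have "1 / (norm x * norm (x - z)) \<le> 1 / (norm x * max (norm x) (a / 2))"
        using True True' tri by (intro le) auto
      then have "ennreal (1 / (norm x * norm (x - z))) \<le> m (norm x)"
        using True by (simp add: m_def ennreal_leI)
      then show ?thesis unfolding eq by (rule order_trans) simp
    next
      case False
      then have "1 / (norm x * norm (x - z)) \<le> 1 / (norm (x - z) * max (norm (x - z)) (a / 2))"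
        using True tri by (subst mult.commute, intro le) auto
      then have "ennreal (1 / (norm x * norm (x - z))) \<le> m (norm (x - z))"
        using True False by (simp add: m_def ennreal_leI)
      then show ?thesis unfolding eq by (rule order_trans) simp
    qed
  qed (auto split: split_indicator)
  then have "(\<integral>\<^sup>+x. indicator (ball 0 \<rho>) x * ennreal (1 / norm x) * ennreal (1 / norm (x - z)) \<partial>lborel)
     \<le> (\<integral>\<^sup>+x. m (norm x) + m (norm (x - z)) \<partial>lborel)"
    by (intro nn_integral_mono)
  also have "\<dots> = (\<integral>\<^sup>+x. m (norm (x::complex)) \<partial>lborel) + (\<integral>\<^sup>+x. m (norm (x - z)) \<partial>lborel)"
    by (intro nn_integral_add) measurable
  also have "(\<integral>\<^sup>+x. m (norm (x - z)) \<partial>lborel) = (\<integral>\<^sup>+x. m (norm (x::complex)) \<partial>lborel)"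
    by (rule nn_integral_lborel_shift_diff) measurable
  also have "(\<integral>\<^sup>+x. m (norm (x::complex)) \<partial>lborel)
      = (\<integral>\<^sup>+s. indicator {0<..} s * ennreal (2 * pi * s) * m s \<partial>lborel)"
    by (rule nn_integral_radial) measurable
  also have "\<dots> \<le> (\<integral>\<^sup>+s. ennreal (2 * pi) * (indicator {a<..<r} s * ennreal (1 / s)
      + (ennreal (1 / r) * indicator {0<..<\<rho>} s + ennreal (2 / a) * indicator {0<..a} s)) \<partial>lborel)"
  proof (intro nn_integral_mono)
    fix s :: real
    show "indicator {0<..} s * ennreal (2 * pi * s) * m s \<le> ennreal (2 * pi) * (indicator {a<..<r} s * ennreal (1 / s)
      + (ennreal (1 / r) * indicator {0<..<\<rho>} s + ennreal (2 / a) * indicator {0<..a} s))"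
    proof (cases "0 < s \<and> s < \<rho>")
      case True
      then have "0 \<le> s * max s (a / 2)" "0 \<le> max s (a / 2)"
        by (simp_all add: le_max_iff_disj)
      with True have "indicator {0<..} s * ennreal (2 * pi * s) * m s = ennreal (2 * pi) * ennreal (1 / max s (a / 2))"
        by (simp add: m_def ennreal_mult[symmetric])
      also have "ennreal (1 / max s (a / 2)) \<le> indicator {a<..<r} s * ennreal (1 / s)
      + (ennreal (1 / r) * indicator {0<..<\<rho>} s + ennreal (2 / a) * indicator {0<..a} s)"
      proof -
        consider "s \<le> a" | "a < s" "s < r" | "a < s" "r \<le> s" by linarith
        then show ?thesis
        proof cases
          case 1
          then have "1 / max s (a / 2) \<le> 2 / a" using True by (auto simp: max_def field_simps)
          then have "ennreal (1 / max s (a / 2)) \<le> ennreal (2 / a) * indicator {0<..a} s"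
            using 1 True by (simp add: ennreal_leI)
          then show ?thesis by (rule order_trans) (simp add: add_increasing)
        next
          case 2
          then have "max s (a / 2) = s" using a by (simp add: max_def)
          then show ?thesis using 2 by simp
        next
          case 3
          then have "1 / max s (a / 2) \<le> 1 / r" using True assms by (auto simp: max_def field_simps)
          then have "ennreal (1 / max s (a / 2)) \<le> ennreal (1 / r) * indicator {0<..<\<rho>} s"
            using 3 True by (simp add: ennreal_leI)
          then show ?thesis by (rule order_trans) (simp add: add_increasing add_increasing2)
        qed
      qed
      finally show ?thesis by (simp add: mult_left_mono)
    qed (auto simp: m_def split: split_indicator)
  qed
  also have "\<dots> = ennreal (2 * pi) * (log_kernel r a + (ennreal (1 / r) * ennreal \<rho> + ennreal (2 / a) * ennreal a))"
    using a assms unfolding log_kernel_def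
    by (subst nn_integral_cmult, measurable, subst nn_integral_add, measurable, subst nn_integral_add, measurable)
      (simp add: nn_integral_cmult_indicator)
  also have "\<dots> \<le> ennreal (2 * pi) * (log_kernel r a + ennreal (\<rho> / r + 2))"
    using a assms
    by (intro mult_left_mono add_left_mono) (auto simp: ennreal_mult[symmetric] ennreal_plus[symmetric] simp del: ennreal_plus intro!: ennreal_leI)
  finally have "(\<integral>\<^sup>+x. indicator (ball 0 \<rho>) x * ennreal (1 / norm x) * ennreal (1 / norm (x - z)) \<partial>lborel)
    \<le> ennreal (2 * pi) * (log_kernel r a + ennreal (\<rho> / r + 2)) + ennreal (2 * pi) * (log_kernel r a + ennreal (\<rho> / r + 2))"
    by (simp add: add_mono)
  also have "\<dots> = ennreal (4 * pi) * (log_kernel r a + ennreal (\<rho> / r + 2))"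
    by (simp add: distrib_right[symmetric] ennreal_plus[symmetric] del: ennreal_plus)
  finally show ?thesis by (simp add: a_def)
qed

section \<open>Size of the increments of the kernel\<close>

definition kernel_increment :: "complex \<Rightarrow> complex \<Rightarrow> complex" where
  "kernel_increment h x = inverse (x + h) - inverse x"

lemma measurable_kernel_increment [measurable (raw)]:
  assumes [measurable]: "f \<in> borel_measurable M" "g \<in> borel_measurable M"
  shows "(\<lambda>x. kernel_increment (f x) (g x)) \<in> borel_measurable M"
  unfolding kernel_increment_def by measurable

text \<open>For \<open>norm x < 2 * r\<close> the two terms are bounded separately. Beyond that
  radius \<open>norm (x + h) \<ge> norm x / 2\<close>, and a common denominator shows the
  cancellation: the decay improves from \<open>1 / norm x\<close> to \<open>1 / norm x^2\<close>, on
  which convergence at infinity rests.\<close>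

lemma norm_kernel_increment_le:
  assumes "norm h < r"
  shows "ennreal (norm (kernel_increment h x))
    \<le> (indicator (ball 0 (3 * r)) x * ennreal (1 / norm x)
       + indicator (ball 0 (3 * r)) (x + h) * ennreal (1 / norm (x + h)))
       + indicator {2 * r..} (norm x) * ennreal (2 * r / (norm x)\<^sup>2)"
proof (cases "norm x < 2 * r")
  case True
  have r: "0 < r" using assms norm_ge_zero[of h] by linarith
  have "norm (x + h) < 3 * r" using norm_triangle_ineq[of x h] True assms by linarith
  then have "indicator (ball 0 (3 * r)) x = (1::ennreal)" "indicator (ball 0 (3 * r)) (x + h) = (1::ennreal)"
    using True r by (simp_all add: indicator_def)
  moreover have "norm (kernel_increment h x) \<le> 1 / norm x + 1 / norm (x + h)"
    unfolding kernel_increment_def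
    using norm_triangle_ineq4[of "inverse (x + h)" "inverse x"] by (simp add: norm_inverse divide_inverse)
  ultimately show ?thesis using True
    by (simp add: ennreal_plus[symmetric] ennreal_leI del: ennreal_plus)
next
  case False
  have r: "0 < r" using assms norm_ge_zero[of h] by linarith
  have *: "norm x / 2 \<le> norm (x + h)"
    using norm_triangle_ineq4[of "x + h" h] False assms by simp
  have x: "0 < norm x" using False r by linarith
  then have xh: "0 < norm (x + h)" using * by linarith
  have "kernel_increment h x = - h / (x * (x + h))"
    using x xh unfolding kernel_increment_def by (simp add: field_simps)
  then have "norm (kernel_increment h x) = norm h / (norm x * norm (x + h))"
    by (simp add: norm_divide norm_mult)
  also have "\<dots> \<le> r / (norm x * (norm x / 2))"
    using x xh * assms r by (intro frac_le mult_left_mono mult_pos_pos) auto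
  also have "\<dots> = 2 * r / (norm x)\<^sup>2" by (simp add: power2_eq_square)
  finally have "ennreal (norm (kernel_increment h x)) \<le> indicator {2 * r..} (norm x) * ennreal (2 * r / (norm x)\<^sup>2)"
    using False by (simp add: ennreal_leI)
  then show ?thesis by (rule order_trans) (simp add: add_increasing)
qed

text \<open>Again uniformly in \<open>z\<close>: where \<open>x - z\<close> is short, the first
  factor is at most its value at radius \<open>2 * r\<close> and the singularity is locally
  integrable; elsewhere inverse cubes dominate the product, and they are integrable away from 0. The
  pieces add up to \<open>6 * pi\<close>, which is rounded up.\<close>

lemma inverse_norm_tail_product:
  assumes r: "0 < r"
  shows "(\<integral>\<^sup>+x. indicator {2 * r..} (norm x) * ennreal (2 * r / (norm x)\<^sup>2) * ennreal (1 / norm (x - z :: complex)) \<partial>lborel)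
    \<le> ennreal (8 * pi)"
proof -
  define A where "A x = indicator {2 * r..} (norm x) * ennreal (1 / norm x ^ 3)" for x :: complex
  define B where "B x = indicator (ball 0 (2 * r)) x * ennreal (1 / norm x)" for x :: complex
  have [measurable]: "A \<in> borel_measurable borel" "B \<in> borel_measurable borel"
    unfolding A_def B_def by measurable
  have "(\<integral>\<^sup>+x. indicator {2 * r..} (norm x) * ennreal (2 * r / (norm x)\<^sup>2) * ennreal (1 / norm (x - z)) \<partial>lborel)
    \<le> (\<integral>\<^sup>+x. ennreal (2 * r) * (A x + A (x - z)) + ennreal (1 / (2 * r)) * B (x - z) \<partial>lborel)"
  proof (intro nn_integral_mono)
    fix x
    show "indicator {2 * r..} (norm x) * ennreal (2 * r / (norm x)\<^sup>2) * ennreal (1 / norm (x - z))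
      \<le> ennreal (2 * r) * (A x + A (x - z)) + ennreal (1 / (2 * r)) * B (x - z)"
    proof (cases "2 * r \<le> norm x")
      case True
      then have x: "0 < norm x" using r by linarith
      have lhs: "indicator {2 * r..} (norm x) * ennreal (2 * r / (norm x)\<^sup>2) * ennreal (1 / norm (x - z))
        = ennreal (2 * r / (norm x)\<^sup>2 * (1 / norm (x - z)))"
        using True r by (subst ennreal_mult) auto
      show ?thesis
      proof (cases "norm (x - z) < 2 * r")
        case near: True
        have "2 * r / (norm x)\<^sup>2 \<le> 2 * r / (2 * r)\<^sup>2"
          using True r by (intro divide_left_mono power_mono mult_pos_pos) auto
        also have "\<dots> = 1 / (2 * r)" using r by (simp add: power2_eq_square)
        finally have "2 * r / (norm x)\<^sup>2 * (1 / norm (x - z)) \<le> 1 / (2 * r) * (1 / norm (x - z))"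
          by (intro mult_right_mono) auto
        then have "ennreal (2 * r / (norm x)\<^sup>2 * (1 / norm (x - z))) \<le> ennreal (1 / (2 * r)) * B (x - z)"
          using near r unfolding B_def by (simp add: ennreal_leI ennreal_mult[symmetric])
        then show ?thesis unfolding lhs by (rule order_trans) simp
      next
        case far: False
        then have xz: "0 < norm (x - z)" using r by linarith
        have le: "1 / (u\<^sup>2 * v) \<le> 1 / u ^ 3 + 1 / v ^ 3" if "0 < u" "0 < v" for u v :: real
        proof (cases "u \<le> v")
          case True
          then have "1 / (u\<^sup>2 * v) \<le> 1 / u ^ 3"
            using that by (intro divide_left_mono) (auto simp: power2_eq_square power3_eq_cube)
          then show ?thesis using that by (simp add: add_increasing2)
        next
          case False
          then have "v\<^sup>2 * v \<le> u\<^sup>2 * v" using that by (intro mult_right_mono power_mono) auto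
          then have "1 / (u\<^sup>2 * v) \<le> 1 / v ^ 3"
            using that by (intro divide_left_mono) (auto simp: power2_eq_square power3_eq_cube)
          then show ?thesis using that by (simp add: add_increasing)
        qed
        have "2 * r / (norm x)\<^sup>2 * (1 / norm (x - z)) = 2 * r * (1 / ((norm x)\<^sup>2 * norm (x - z)))" by simp
        also have "\<dots> \<le> 2 * r * (1 / norm x ^ 3 + 1 / norm (x - z) ^ 3)"
          using le[OF x xz] r by (intro mult_left_mono) auto
        finally have "ennreal (2 * r / (norm x)\<^sup>2 * (1 / norm (x - z))) \<le> ennreal (2 * r) * (A x + A (x - z))"
          using far True r unfolding A_def
          by (simp add: ennreal_leI ennreal_mult[symmetric] ennreal_plus[symmetric] del: ennreal_plus)
        then show ?thesis unfolding lhs by (rule order_trans) simp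
      qed
    qed simp
  qed
  also have "\<dots> = ennreal (2 * r) * ((\<integral>\<^sup>+x. A x \<partial>lborel) + (\<integral>\<^sup>+x. A (x - z) \<partial>lborel))
      + ennreal (1 / (2 * r)) * (\<integral>\<^sup>+x. B (x - z) \<partial>lborel)"
    by (simp add: nn_integral_add nn_integral_cmult)
  also have "\<dots> = ennreal (2 * r) * ((\<integral>\<^sup>+x. A x \<partial>lborel) + (\<integral>\<^sup>+x. A x \<partial>lborel))
      + ennreal (1 / (2 * r)) * (\<integral>\<^sup>+x. B x \<partial>lborel)"
    by (simp add: nn_integral_lborel_shift_diff)
  also have "\<dots> \<le> ennreal (2 * r) * (ennreal (2 * pi / (2 * r)) + ennreal (2 * pi / (2 * r)))
      + ennreal (1 / (2 * r)) * ennreal (2 * pi * (2 * r))"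
    unfolding A_def B_def using r
    by (intro add_mono mult_left_mono nn_integral_inverse_norm_cube nn_integral_inverse_norm_ball) auto
  also have "\<dots> = ennreal (6 * pi)"
    using r by (simp add: ennreal_mult[symmetric] ennreal_plus[symmetric] del: ennreal_plus)
  also have "\<dots> \<le> ennreal (8 * pi)" by (intro ennreal_leI) simp
  finally show ?thesis .
qed

text \<open>An absolute bound that makes Fubini applicable, with \<open>c\<close> independent of
  \<open>z\<close>. The integral over \<open>h\<close> matters: for fixed \<open>h\<close> the pole
  of the increment at \<open>- h\<close> makes the integral over \<open>x\<close> large when
  \<open>z\<close> is near \<open>- h\<close>, and integrating over the disc smooths this
  out.\<close>

lemma kernel_increment_product_bound:
  assumes r: "0 < r"
  obtains c where "0 \<le> c" "\<And>z. (\<integral>\<^sup>+h. indicator (ball 0 r) h *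
      (\<integral>\<^sup>+x. ennreal (norm (kernel_increment h x)) * ennreal (1 / norm (x - z)) \<partial>lborel) \<partial>lborel)
    \<le> ennreal c * (1 + log_kernel r (norm z))"
proof
  define P where "P x = indicator (ball 0 (3 * r)) x * ennreal (1 / norm x)" for x :: complex
  define Q where "Q x = indicator {2 * r..} (norm x) * ennreal (2 * r / (norm x)\<^sup>2)" for x :: complex
  define w where "w x = ennreal (1 / norm x)" for x :: complex
  have [measurable]: "P \<in> borel_measurable borel" "Q \<in> borel_measurable borel" "w \<in> borel_measurable borel"
    unfolding P_def Q_def w_def by measurable
  define I where "I = (indicator (ball 0 r) :: complex \<Rightarrow> ennreal)"
  have [measurable]: "I \<in> borel_measurable borel" unfolding I_def by measurable
  have II: "(\<integral>\<^sup>+h. I h \<partial>lborel) = ennreal (pi * r\<^sup>2)"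
    unfolding I_def using r by (simp add: emeasure_ball unit_ball_vol_2)
  \<comment> \<open>The summands belong to the pole at 0, the pole at \<open>- h\<close> and the
    tail; 5 is \<open>3 * r / r + 2\<close> from
    \<open>nn_integral_inverse_norm_product\<close>.\<close>
  define c where "c = pi * r\<^sup>2 * (4 * pi) * 5 + 6 * pi * r * (2 * pi + pi * (4 * r)\<^sup>2) + pi * r\<^sup>2 * (8 * pi)"
  show "0 \<le> c" using r by (simp add: c_def)
  fix z :: complex
  define L where "L = log_kernel r (norm z)"
  have PP: "(\<integral>\<^sup>+x. P x * w (x - z) \<partial>lborel) \<le> ennreal (4 * pi) * (L + ennreal 5)"
    using nn_integral_inverse_norm_product[of r "3 * r" z] r unfolding P_def w_def L_def by simp
  have QQ: "(\<integral>\<^sup>+x. Q x * w (x - z) \<partial>lborel) \<le> ennreal (8 * pi)"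
    using inverse_norm_tail_product[OF r, of z] unfolding Q_def w_def .
  have PS: "(\<integral>\<^sup>+h. I h * (\<integral>\<^sup>+x. P (x + h) * w (x - z) \<partial>lborel) \<partial>lborel)
    \<le> ennreal (6 * pi * r * (2 * pi + pi * (4 * r)\<^sup>2))"
  proof -
    have "(\<integral>\<^sup>+h. I h * (\<integral>\<^sup>+x. P (x + h) * w (x - z) \<partial>lborel) \<partial>lborel)
      = (\<integral>\<^sup>+h. (\<integral>\<^sup>+x. I h * (P (x + h) * w (x - z)) \<partial>lborel) \<partial>lborel)"
      by (intro nn_integral_cong nn_integral_cmult[symmetric]) measurable
    \<comment> \<open>After the exchange the moving pole is integrated over \<open>h\<close> alone
      and leaves a constant, while \<open>norm x \<le> norm (x + h) + norm h < 4 * r\<close>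
      confines \<open>x\<close>.\<close>
    also have "\<dots> = (\<integral>\<^sup>+x. (\<integral>\<^sup>+h. I h * (P (x + h) * w (x - z)) \<partial>lborel) \<partial>lborel)"
      by (rule lborel_pair.Fubini') measurable
    also have "\<dots> \<le> (\<integral>\<^sup>+x. (indicator (ball 0 (4 * r)) x * w (x - z)) * ennreal (2 * pi * (3 * r)) \<partial>lborel)"
    proof (intro nn_integral_mono)
      fix x :: complex
      have "(\<integral>\<^sup>+h. I h * (P (x + h) * w (x - z)) \<partial>lborel)
        \<le> (\<integral>\<^sup>+h. (indicator (ball 0 (4 * r)) x * w (x - z)) * P (h + x) \<partial>lborel)"
      proof (intro nn_integral_mono)
        fix h :: complex
        have "norm x < 4 * r" if "norm h < r" "norm (x + h) < 3 * r"
          using norm_triangle_ineq4[of "x + h" h] that by simp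
        then show "I h * (P (x + h) * w (x - z)) \<le> (indicator (ball 0 (4 * r)) x * w (x - z)) * P (h + x)"
          by (auto simp: I_def P_def add.commute mult_ac split: split_indicator)
      qed
      also have "\<dots> = (indicator (ball 0 (4 * r)) x * w (x - z)) * (\<integral>\<^sup>+h. P (h + x) \<partial>lborel)"
        by (rule nn_integral_cmult) measurable
      also have "(\<integral>\<^sup>+h. P (h + x) \<partial>lborel) = (\<integral>\<^sup>+h. P h \<partial>lborel)"
        by (rule nn_integral_lborel_shift) measurable
      also have "\<dots> \<le> ennreal (2 * pi * (3 * r))"
        unfolding P_def using r by (intro nn_integral_inverse_norm_ball) simp
      finally show "(\<integral>\<^sup>+h. I h * (P (x + h) * w (x - z)) \<partial>lborel)
        \<le> (indicator (ball 0 (4 * r)) x * w (x - z)) * ennreal (2 * pi * (3 * r))"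
        by (simp add: mult_left_mono)
    qed
    also have "\<dots> = (\<integral>\<^sup>+x. indicator (ball 0 (4 * r)) x * w (x - z) \<partial>lborel) * ennreal (2 * pi * (3 * r))"
      by (rule nn_integral_multc) measurable
    also have "\<dots> \<le> ennreal (2 * pi + pi * (4 * r)\<^sup>2) * ennreal (2 * pi * (3 * r))"
      unfolding w_def using r by (intro mult_right_mono nn_integral_inverse_norm_shifted_ball) auto
    also have "\<dots> = ennreal (6 * pi * r * (2 * pi + pi * (4 * r)\<^sup>2))"
      using r by (subst ennreal_mult[symmetric]) (auto simp: mult_ac)
    finally show ?thesis .
  qed
  have "(\<integral>\<^sup>+h. indicator (ball 0 r) h *
      (\<integral>\<^sup>+x. ennreal (norm (kernel_increment h x)) * ennreal (1 / norm (x - z)) \<partial>lborel) \<partial>lborel)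
    \<le> (\<integral>\<^sup>+h. I h * (\<integral>\<^sup>+x. (P x * w (x - z) + P (x + h) * w (x - z)) + Q x * w (x - z) \<partial>lborel) \<partial>lborel)"
  proof (intro nn_integral_mono)
    fix h :: complex
    show "indicator (ball 0 r) h * (\<integral>\<^sup>+x. ennreal (norm (kernel_increment h x)) * ennreal (1 / norm (x - z)) \<partial>lborel)
      \<le> I h * (\<integral>\<^sup>+x. (P x * w (x - z) + P (x + h) * w (x - z)) + Q x * w (x - z) \<partial>lborel)"
    proof (cases "norm h < r")
      case True
      have "(\<integral>\<^sup>+x. ennreal (norm (kernel_increment h x)) * ennreal (1 / norm (x - z)) \<partial>lborel)
       \<le> (\<integral>\<^sup>+x. (P x * w (x - z) + P (x + h) * w (x - z)) + Q x * w (x - z) \<partial>lborel)"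
        using norm_kernel_increment_le[OF True]
        by (intro nn_integral_mono) (simp add: P_def Q_def w_def distrib_right[symmetric] mult_right_mono)
      then show ?thesis unfolding I_def by (intro mult_left_mono) auto
    qed (simp add: I_def)
  qed
  also have "\<dots> = (\<integral>\<^sup>+h. (I h * (\<integral>\<^sup>+x. P x * w (x - z) \<partial>lborel) + I h * (\<integral>\<^sup>+x. P (x + h) * w (x - z) \<partial>lborel))
      + I h * (\<integral>\<^sup>+x. Q x * w (x - z) \<partial>lborel) \<partial>lborel)"
    by (intro nn_integral_cong) (simp add: nn_integral_add distrib_left)
  also have "\<dots> = ((\<integral>\<^sup>+h. I h \<partial>lborel) * (\<integral>\<^sup>+x. P x * w (x - z) \<partial>lborel)
      + (\<integral>\<^sup>+h. I h * (\<integral>\<^sup>+x. P (x + h) * w (x - z) \<partial>lborel) \<partial>lborel))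
      + (\<integral>\<^sup>+h. I h \<partial>lborel) * (\<integral>\<^sup>+x. Q x * w (x - z) \<partial>lborel)"
    by (simp add: nn_integral_add nn_integral_multc)
  also have "\<dots> \<le> (ennreal (pi * r\<^sup>2) * (ennreal (4 * pi) * (L + ennreal 5))
      + ennreal (6 * pi * r * (2 * pi + pi * (4 * r)\<^sup>2))) + ennreal (pi * r\<^sup>2) * ennreal (8 * pi)"
    unfolding II by (intro add_mono mult_left_mono PP QQ PS) auto
  also have "\<dots> = ennreal (pi * r\<^sup>2 * (4 * pi)) * L + ennreal c"
  proof -
    have "ennreal a * (ennreal b * (L + ennreal 5)) + ennreal e + ennreal a * ennreal d
      = ennreal (a * b) * L + ennreal (a * b * 5 + e + a * d)"
      if "0 \<le> a" "0 \<le> b" "0 \<le> e" "0 \<le> d" for a b d e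
      using that by (simp add: distrib_left ennreal_mult mult.assoc add.assoc)
    from this[of "pi * r\<^sup>2" "4 * pi" "6 * pi * r * (2 * pi + pi * (4 * r)\<^sup>2)" "8 * pi"]
    show ?thesis using r unfolding c_def by (simp only: zero_le_mult_iff) simp
  qed
  also have "\<dots> \<le> ennreal c * L + ennreal c"
    using r by (intro add_right_mono mult_right_mono ennreal_leI) (auto simp: c_def)
  finally show "(\<integral>\<^sup>+h. indicator (ball 0 r) h *
      (\<integral>\<^sup>+x. ennreal (norm (kernel_increment h x)) * ennreal (1 / norm (x - z)) \<partial>lborel) \<partial>lborel)
    \<le> ennreal c * (1 + log_kernel r (norm z))"
    by (simp add: L_def distrib_left add.commute)
qed

section \<open>Disc averages of the kernel\<close>

lemma integral_lborel_shift:
  fixes f :: "'a::euclidean_space \<Rightarrow> 'b::{banach, second_countable_topology}"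
  assumes [measurable]: "f \<in> borel_measurable borel"
  shows "(\<integral>x. f (x + c) \<partial>lborel) = (\<integral>x. f x \<partial>lborel)"
proof -
  have "(\<lambda>x. x + c) = (+) c" by (simp add: fun_eq_iff add.commute)
  then have "distr lborel borel (\<lambda>x. x + c) = lborel" by (simp only: lborel_distr_plus)
  then show ?thesis using integral_distr[of "\<lambda>x. x + c" lborel borel f] by simp
qed

lemma measurable_cnj [measurable]: "cnj \<in> borel_measurable borel"
  by (intro borel_measurable_continuous_onI continuous_intros)

text \<open>Polar integration with only the angle carried out: since rotations preserve Lebesgue
  measure, \<open>f\<close> may be replaced by its circle averages \<open>g\<close>. These are
  prescribed only almost everywhere, because circles through a singularity of \<open>f\<close> are
  exceptional.\<close>

lemma integral_rotation_average:
  fixes f g :: "complex \<Rightarrow> complex"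
  assumes f: "integrable lborel f" and g: "g \<in> borel_measurable borel"
    and avg: "AE x in lborel. ((\<lambda>t. f (cis t * x)) has_integral 2 * pi * g x) {0..2*pi}"
  shows "integral\<^sup>L lborel f = integral\<^sup>L lborel g"
proof -
  have [measurable]: "f \<in> borel_measurable borel" using f by auto
  have [measurable]: "cis \<in> borel_measurable borel"
    by (intro borel_measurable_continuous_onI continuous_on_cis continuous_on_id)
  have rot: "integrable lborel (\<lambda>x. f (cis t * x))" "(\<integral>x. f (cis t * x) \<partial>lborel) = integral\<^sup>L lborel f"
    "(\<integral>x. norm (f (cis t * x)) \<partial>lborel) = (\<integral>x. norm (f x) \<partial>lborel)" for t
  proof -
    have "integrable (distr lborel borel ((*) (cis t))) f" using f by (simp add: distr_cis_mult)
    then show "integrable lborel (\<lambda>x. f (cis t * x))" by (subst (asm) integrable_distr_eq) auto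
    have "integral\<^sup>L (distr lborel borel ((*) (cis t))) f = (\<integral>x. f (cis t * x) \<partial>lborel)"
      by (rule integral_distr) auto
    then show "(\<integral>x. f (cis t * x) \<partial>lborel) = integral\<^sup>L lborel f" by (simp add: distr_cis_mult)
    have "(\<integral>x. norm (f x) \<partial>distr lborel borel ((*) (cis t))) = (\<integral>x. norm (f (cis t * x)) \<partial>lborel)"
      by (rule integral_distr) auto
    then show "(\<integral>x. norm (f (cis t * x)) \<partial>lborel) = (\<integral>x. norm (f x) \<partial>lborel)" by (simp add: distr_cis_mult)
  qed
  define F where "F t x = indicator {0..2*pi} t *\<^sub>R f (cis t * x)" for t :: real and x
  have F: "integrable (lborel \<Otimes>\<^sub>M lborel) (case_prod F)"
  proof (rule lborel_pair.Fubini_integrable)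
    show "case_prod F \<in> borel_measurable (lborel \<Otimes>\<^sub>M lborel)"
      unfolding F_def by measurable
    have "(\<lambda>t. \<integral>x. norm (case_prod F (t, x)) \<partial>lborel) = (\<lambda>t. indicator {0..2*pi} t *\<^sub>R (\<integral>x. norm (f x) \<partial>lborel))"
      by (simp add: F_def rot)
    then show "integrable lborel (\<lambda>t. \<integral>x. norm (case_prod F (t, x)) \<partial>lborel)"
      by simp
    show "AE t in lborel. integrable lborel (\<lambda>x. case_prod F (t, x))"
      unfolding F_def using rot(1) by auto
  qed
  have "(\<integral>x. (\<integral>t. F t x \<partial>lborel) \<partial>lborel) = (\<integral>t. (\<integral>x. F t x \<partial>lborel) \<partial>lborel)"
    using F by (rule lborel_pair.Fubini_integral)
  also have "\<dots> = (\<integral>t. indicator {0..2*pi} t *\<^sub>R integral\<^sup>L lborel f \<partial>lborel)"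
    by (simp add: F_def rot)
  also have "\<dots> = 2 * pi * integral\<^sup>L lborel f"
    by (simp add: scaleR_conv_of_real)
  also have "(\<integral>x. (\<integral>t. F t x \<partial>lborel) \<partial>lborel) = (\<integral>x. 2 * pi * g x \<partial>lborel)"
  proof (rule integral_cong_AE)
    show "(\<lambda>x. \<integral>t. F t x \<partial>lborel) \<in> borel_measurable lborel"
      unfolding F_def by measurable
    show "(\<lambda>x. 2 * pi * g x) \<in> borel_measurable lborel" using g by simp
    \<comment> \<open>Lebesgue integrability in \<open>t\<close> identifies the Lebesgue integral
      with the gauge integral in the hypothesis \<open>avg\<close>.\<close>
    have "AE x in lborel. integrable lborel (\<lambda>t. F t x)"
      using F by (rule lborel_pair.AE_integrable_snd)
    with avg show "AE x in lborel. (\<integral>t. F t x \<partial>lborel) = 2 * pi * g x"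
    proof eventually_elim
      case (elim x)
      then have "set_integrable lborel {0..2*pi} (\<lambda>t. f (cis t * x))"
        by (simp add: set_integrable_def F_def)
      from set_borel_integral_eq_integral(2)[OF this] show ?case
        using elim(1) by (simp add: set_lebesgue_integral_def F_def integral_unique)
    qed
  qed
  finally show ?thesis by simp
qed

text \<open>The difference of \<open>inverse x\<close> and the average of \<open>inverse (x + h)\<close> over the disc \<open>\<bar>h\<bar> < r\<close>: it is
  supported in the disc because of the mean value property.\<close>

definition cut_kernel :: "real \<Rightarrow> complex \<Rightarrow> complex" where
  "cut_kernel r x = (if norm x < r then (1 - (norm x / r)\<^sup>2) *\<^sub>R inverse x else 0)"

lemma measurable_cut_kernel [measurable]: "cut_kernel r \<in> borel_measurable borel"
  unfolding cut_kernel_def by measurable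

lemma AE_norm_neq: "AE x in lborel. norm (x::complex) \<noteq> \<rho>"
proof -
  have "sphere (0::complex) \<rho> \<in> null_sets lborel"
    using negligible_sphere[of "0::complex" \<rho>] by (auto simp: null_sets_completion_iff negligible_iff_null_sets)
  then show ?thesis by (rule AE_I') (auto simp: sphere_def dist_norm)
qed

text \<open>By \<open>circle_integral_inverse\<close> the circle \<open>norm h = s\<close>
  contributes \<open>inverse z\<close> on average if \<open>s < norm z\<close> and nothing if
  \<open>s > norm z\<close>. Only the disc of radius \<open>min r (norm z)\<close> counts, with its
  area as the factor.\<close>

lemma
  fixes z :: complex
  assumes r: "0 < r"
  shows integrable_ball_inverse: "integrable lborel (\<lambda>h. indicator (ball 0 r) h *\<^sub>R inverse (z + h :: complex))"
    and integral_ball_inverse: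
      "(\<integral>h. indicator (ball 0 r) h *\<^sub>R inverse (z + h :: complex) \<partial>lborel) = pi * (min r (norm z))\<^sup>2 * inverse z"
proof -
  let ?f = "\<lambda>h. indicator (ball 0 r) h *\<^sub>R inverse (z + h :: complex)"
  show int: "integrable lborel ?f"
  proof (rule integrableI_bounded)
    have "(\<integral>\<^sup>+h. ennreal (norm (?f h)) \<partial>lborel) = (\<integral>\<^sup>+h. indicator (ball 0 r) h * ennreal (1 / norm (h - (- z))) \<partial>lborel)"
      by (intro nn_integral_cong) (auto simp: norm_inverse divide_inverse add.commute split: split_indicator)
    also have "\<dots> \<le> ennreal (2 * pi + pi * r\<^sup>2)"
      using r by (intro nn_integral_inverse_norm_shifted_ball) simp
    finally show "(\<integral>\<^sup>+h. ennreal (norm (?f h)) \<partial>lborel) < \<infinity>" by (rule order_le_less_trans) simp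
  qed measurable
  define g where "g h = indicator (ball 0 (min r (norm z))) h *\<^sub>R inverse z" for h :: complex
  have [measurable]: "g \<in> borel_measurable borel" unfolding g_def by measurable
  have "integral\<^sup>L lborel ?f = integral\<^sup>L lborel g"
  proof (rule integral_rotation_average[OF int])
    have "((\<lambda>t. ?f (cis t * h)) has_integral 2 * pi * g h) {0..2*pi}" if "norm h \<noteq> norm z" for h
    proof (cases "norm h < r")
      case True
      have "((\<lambda>t. 1 / (z - cis t * (- h))) has_integral (if norm (- h) < norm z then 2 * pi / z else 0)) {0..2*pi}"
        using that by (intro circle_integral_inverse) simp
      then show ?thesis
        using True by (auto simp: g_def norm_mult indicator_def divide_inverse scaleR_conv_of_real)
    qed (simp add: g_def norm_mult)
    then show "AE h in lborel. ((\<lambda>t. ?f (cis t * h)) has_integral 2 * pi * g h) {0..2*pi}"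
      using AE_norm_neq[of "norm z"] by (auto elim: eventually_mono)
  qed measurable
  also have "\<dots> = pi * (min r (norm z))\<^sup>2 * inverse z"
    using r unfolding g_def by (simp add: content_ball unit_ball_vol_2 scaleR_conv_of_real)
  finally show "integral\<^sup>L lborel ?f = pi * (min r (norm z))\<^sup>2 * inverse z" .
qed

text \<open>For \<open>y = cis t * x\<close> the product is, up to a radial factor, the conjugate of
  \<open>y / (y - z)\<close>, whose circle average is 1 for \<open>norm x > norm z\<close> and 0 for
  \<open>norm x < norm z\<close>. What remains is radial and at most \<open>1 / norm x^2\<close> on
  the annulus between \<open>norm z\<close> and \<open>r\<close>.\<close>

lemma norm_integral_cut_kernel_product:
  assumes r: "0 < r" and z: "z \<noteq> 0"
  shows "ennreal (norm (\<integral>x. cut_kernel r x * cnj (inverse (x - z)) \<partial>lborel)) \<le> ennreal (2 * pi) * log_kernel r (norm z)"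
proof -
  let ?f = "\<lambda>x. cut_kernel r x * cnj (inverse (x - z))"
  have coeff: "\<bar>1 - (norm x / r)\<^sup>2\<bar> \<le> 1" if "norm x < r" for x :: complex
  proof -
    have "norm x / r \<le> 1" using that r by simp
    then have "(norm x / r)\<^sup>2 \<le> 1" using r by (intro power_le_one) auto
    then show ?thesis by simp
  qed
  have int: "integrable lborel ?f"
  proof (rule integrableI_bounded)
    have "(\<integral>\<^sup>+x. ennreal (norm (?f x)) \<partial>lborel)
      \<le> (\<integral>\<^sup>+x. indicator (ball 0 r) x * ennreal (1 / norm x) * ennreal (1 / norm (x - z)) \<partial>lborel)"
    proof (intro nn_integral_mono)
      fix x
      show "ennreal (norm (?f x)) \<le> indicator (ball 0 r) x * ennreal (1 / norm x) * ennreal (1 / norm (x - z))"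
      proof (cases "norm x < r")
        case True
        have "norm (?f x) = \<bar>1 - (norm x / r)\<^sup>2\<bar> * (1 / norm x * (1 / norm (x - z)))"
          using True by (simp add: cut_kernel_def norm_mult norm_inverse divide_inverse del: complex_cnj_inverse complex_cnj_diff)
        also have "\<dots> \<le> 1 * (1 / norm x * (1 / norm (x - z)))"
          by (intro mult_right_mono coeff True) auto
        finally show ?thesis using True by (simp add: ennreal_mult[symmetric] ennreal_leI)
      qed (simp add: cut_kernel_def)
    qed
    also have "\<dots> \<le> ennreal (4 * pi) * (log_kernel r (norm z) + ennreal (r / r + 2))"
      using r by (intro nn_integral_inverse_norm_product) auto
    also have "\<dots> < \<infinity>"
      using log_kernel_finite[of "norm z" r] z by (simp add: ennreal_mult_less_top)
    finally show "(\<integral>\<^sup>+x. ennreal (norm (?f x)) \<partial>lborel) < \<infinity>" .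
  qed measurable
  define g where "g x = (if norm z < norm x \<and> norm x < r then complex_of_real ((1 - (norm x / r)\<^sup>2) / (norm x)\<^sup>2) else 0)" for x :: complex
  have [measurable]: "g \<in> borel_measurable borel" unfolding g_def by measurable
  have "integral\<^sup>L lborel ?f = integral\<^sup>L lborel g"
  proof (rule integral_rotation_average[OF int])
    have "((\<lambda>t. ?f (cis t * x)) has_integral 2 * pi * g x) {0..2*pi}" if "norm x \<noteq> norm z" "norm x \<noteq> 0" for x
    proof (cases "norm x < r")
      case True
      have x: "x \<noteq> 0" using that by simp
      have ne: "cis t * x \<noteq> z" for t using that by (auto simp: norm_mult)
      define A where "A = complex_of_real (1 - (norm x / r)\<^sup>2) / (x * cnj x)"
      have eq: "?f (cis t * x) = A * (1 - cnj z * cnj (1 / (z - cis t * x)))" for t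
      proof -
        have "?f (cis t * x) = complex_of_real (1 - (norm x / r)\<^sup>2) * (inverse (cis t) * inverse x) * cnj (inverse (cis t * x - z))"
          using True by (simp add: cut_kernel_def norm_mult scaleR_conv_of_real)
        \<comment> \<open>On the unit circle inversion is conjugation, so the rotation factor moves
          under the same \<open>cnj\<close> as the second kernel.\<close>
        also have "inverse (cis t) = cnj (cis t)" by (simp add: cis_cnj)
        also have "complex_of_real (1 - (norm x / r)\<^sup>2) * (cnj (cis t) * inverse x) * cnj (inverse (cis t * x - z))
          = A * cnj (cis t * x * inverse (cis t * x - z))"
        proof -
          have "a * (c * inverse x) * K = a / (x * cnj x) * (c * cnj x * K)" for a c K :: complex
            using x by (simp add: field_simps)
          then show ?thesis unfolding A_def complex_cnj_mult by blast
        qed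
        also have "cis t * x * inverse (cis t * x - z) = 1 - z * (1 / (z - cis t * x))"
          using ne[of t] by (simp add: field_simps)
        finally show ?thesis by simp
      qed
      have "((\<lambda>t. 1 / (z - cis t * x)) has_integral (if norm x < norm z then 2 * pi / z else 0)) {0..2*pi}"
        using that by (intro circle_integral_inverse) simp
      then have "((\<lambda>t. cnj (1 / (z - cis t * x))) has_integral cnj (if norm x < norm z then 2 * pi / z else 0)) {0..2*pi}"
        using has_integral_linear[OF _ bounded_linear_cnj, unfolded o_def] by blast
      moreover have "((\<lambda>t. 1) has_integral complex_of_real (2 * pi)) {0..2*pi}"
        using has_integral_const_real[of "1::complex" 0 "2*pi"] by (simp add: scaleR_conv_of_real)
      ultimately have "((\<lambda>t. A * (1 - cnj z * cnj (1 / (z - cis t * x)))) has_integral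
         A * (complex_of_real (2 * pi) - cnj z * cnj (if norm x < norm z then 2 * pi / z else 0))) {0..2*pi}"
        by (intro has_integral_mult_right has_integral_diff)
      also have "A * (complex_of_real (2 * pi) - cnj z * cnj (if norm x < norm z then 2 * pi / z else 0)) = 2 * pi * g x"
        using True that z by (auto simp: g_def A_def complex_norm_square[symmetric] mult_ac)
      finally show ?thesis unfolding eq .
    qed (simp add: g_def cut_kernel_def norm_mult)
    then show "AE x in lborel. ((\<lambda>t. ?f (cis t * x)) has_integral 2 * pi * g x) {0..2*pi}"
      using AE_norm_neq[of "norm z"] AE_norm_neq[of 0] by (auto elim: eventually_elim2)
  qed measurable
  \<comment> \<open>If \<open>g\<close> were not integrable, its Bochner integral would be 0 by
    default and the bound trivial.\<close>
  then have "ennreal (norm (integral\<^sup>L lborel ?f)) \<le> (\<integral>\<^sup>+x. ennreal (norm (g x)) \<partial>lborel)"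
    by (cases "integrable lborel g") (simp_all add: integral_norm_bound_ennreal not_integrable_integral_eq)
  also have "\<dots> \<le> (\<integral>\<^sup>+x. indicator {norm z<..<r} (norm x) * ennreal (1 / (norm (x::complex))\<^sup>2) \<partial>lborel)"
  proof (intro nn_integral_mono)
    fix x :: complex
    show "ennreal (norm (g x)) \<le> indicator {norm z<..<r} (norm x) * ennreal (1 / (norm x)\<^sup>2)"
    proof (cases "norm z < norm x \<and> norm x < r")
      case True
      have "norm (g x) = \<bar>1 - (norm x / r)\<^sup>2\<bar> / (norm x)\<^sup>2"
        using True by (simp add: g_def norm_divide norm_power flip: of_real_power of_real_divide)
      also have "\<dots> \<le> 1 / (norm x)\<^sup>2" using True by (intro divide_right_mono coeff) auto
      finally show ?thesis using True by (simp add: ennreal_leI)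
    qed (auto simp: g_def)
  qed
  also have "\<dots> \<le> ennreal (2 * pi) * log_kernel r (norm z)" by (rule nn_integral_norm_power_annulus)
  finally show "ennreal (norm (integral\<^sup>L lborel ?f)) \<le> ennreal (2 * pi) * log_kernel r (norm z)" .
qed

section \<open>Energy of averaged kernel increments\<close>

text \<open>Lebesgue measure on the disc, not divided by its area; the normalisation is left to the
  end.\<close>

definition ball_measure :: "real \<Rightarrow> complex measure" where
  "ball_measure r = density lborel (indicator (ball 0 r))"

lemma sets_ball_measure [simp, measurable_cong]: "sets (ball_measure r) = sets borel"
  by (simp add: ball_measure_def)

lemma space_ball_measure [simp]: "space (ball_measure r) = UNIV"
  by (simp add: ball_measure_def)

lemma nn_integral_ball_measure:
  "f \<in> borel_measurable borel \<Longrightarrow> (\<integral>\<^sup>+h. f h \<partial>ball_measure r) = (\<integral>\<^sup>+h. indicator (ball 0 r) h * f h \<partial>lborel)"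
  by (simp add: ball_measure_def nn_integral_density)

lemma ball_measure_eq: "ball_measure r = density lborel (\<lambda>h. ennreal (indicator (ball 0 r) h))"
  unfolding ball_measure_def by (simp add: ennreal_indicator)

lemma integral_ball_measure:
  fixes f :: "complex \<Rightarrow> 'a::{banach, second_countable_topology}"
  shows "f \<in> borel_measurable borel \<Longrightarrow> (\<integral>h. f h \<partial>ball_measure r) = (\<integral>h. indicator (ball 0 r) h *\<^sub>R f h \<partial>lborel)"
  unfolding ball_measure_eq by (subst integral_density) auto

lemma finite_measure_ball_measure: "finite_measure (ball_measure r)"
  using emeasure_lborel_ball_finite[of "0::complex" r]
  by (intro finite_measureI) (simp add: ball_measure_def emeasure_density)

lemma integral_ball_measure_uminus:
  fixes f :: "complex \<Rightarrow> complex"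
  assumes [measurable]: "f \<in> borel_measurable borel"
  shows "(\<integral>h. f (- h) \<partial>ball_measure r) = (\<integral>h. f h \<partial>ball_measure r)"
proof -
  have "(\<integral>h. indicator (ball 0 r) h *\<^sub>R f h \<partial>distr lborel borel (\<lambda>x::complex. - x))
    = (\<integral>h. indicator (ball 0 r) (- h) *\<^sub>R f (- h) \<partial>lborel)"
    by (rule integral_distr) measurable
  moreover have "indicator (ball 0 r) (- h) = (indicator (ball 0 r) h :: real)" for h :: complex
    by (simp add: indicator_def)
  ultimately show ?thesis by (simp add: distr_uminus_complex integral_ball_measure)
qed

lemma nn_integral_ball_measure_uminus:
  assumes [measurable]: "f \<in> borel_measurable borel"
  shows "(\<integral>\<^sup>+h. f (- h) \<partial>ball_measure r) = (\<integral>\<^sup>+h. f h \<partial>ball_measure r)"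
proof -
  have "(\<integral>\<^sup>+h. indicator (ball 0 r) h * f h \<partial>distr lborel borel (\<lambda>x::complex. - x))
    = (\<integral>\<^sup>+h. indicator (ball 0 r) (- h) * f (- h) \<partial>lborel)"
    by (rule nn_integral_distr) measurable
  moreover have "indicator (ball 0 r) (- h) = (indicator (ball 0 r) h :: ennreal)" for h :: complex
    by (simp add: indicator_def)
  ultimately show ?thesis by (simp add: distr_uminus_complex nn_integral_ball_measure)
qed

text \<open>Substituting \<open>x + h\<close> for \<open>x\<close> and \<open>- h\<close> for \<open>h\<close> turns one of the two terms of the second
  increment into the other one, which leaves twice the integral of a single product that decays like
  \<open>\<bar>x\<bar>\<^sup>-\<^sup>3\<close>. This avoids cutting off the individual products, which are not integrable at infinity.\<close>

lemma norm_integral_kernel_increment_product: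
  assumes r: "0 < r" and z: "z \<noteq> 0"
  defines "N \<equiv> ball_measure r \<Otimes>\<^sub>M (lborel :: complex measure)"
  shows "ennreal (norm (\<integral>(h, x). kernel_increment h x * cnj (kernel_increment h (x - z)) \<partial>N))
      \<le> ennreal (4 * pi\<^sup>2 * r\<^sup>2) * log_kernel r (norm z)"
proof -
  interpret B: finite_measure "ball_measure r" by (rule finite_measure_ball_measure)
  interpret N: pair_sigma_finite "ball_measure r" "lborel :: complex measure" ..
  define g where "g h x = kernel_increment h x * cnj (inverse (x - z))" for h x
  have [measurable]: "case_prod g \<in> borel_measurable (borel \<Otimes>\<^sub>M borel)"
    unfolding g_def by measurable
  have nn: "(\<integral>\<^sup>+h. (\<integral>\<^sup>+x. ennreal (norm (g h x)) \<partial>lborel) \<partial>ball_measure r) < \<infinity>"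
  proof -
    obtain c where c: "0 \<le> c" "\<And>z. (\<integral>\<^sup>+h. indicator (ball 0 r) h *
      (\<integral>\<^sup>+x. ennreal (norm (kernel_increment h x)) * ennreal (1 / norm (x - z)) \<partial>lborel) \<partial>lborel)
       \<le> ennreal c * (1 + log_kernel r (norm z))"
      by (rule kernel_increment_product_bound[OF r]) (rule that)
    have "ennreal (norm (g h x)) = ennreal (norm (kernel_increment h x)) * ennreal (1 / norm (x - z))" for h x
      by (simp add: g_def ennreal_mult[symmetric] norm_mult norm_inverse divide_inverse del: complex_cnj_inverse complex_cnj_diff)
    then have "(\<integral>\<^sup>+h. (\<integral>\<^sup>+x. ennreal (norm (g h x)) \<partial>lborel) \<partial>ball_measure r)
      = (\<integral>\<^sup>+h. indicator (ball 0 r) h *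
      (\<integral>\<^sup>+x. ennreal (norm (kernel_increment h x)) * ennreal (1 / norm (x - z)) \<partial>lborel) \<partial>lborel)"
      by (simp add: nn_integral_ball_measure)
    also have "\<dots> \<le> ennreal c * (1 + log_kernel r (norm z))" by (rule c(2))
    \<comment> \<open>Here \<open>z \<noteq> 0\<close> is essential: for coinciding poles the
      integrand would contain the non-integrable \<open>1 / norm x^2\<close>.\<close>
    also have "ennreal c * (1 + log_kernel r (norm z)) < \<infinity>"
      using log_kernel_finite[of "norm z" r] z by (simp add: ennreal_mult_less_top)
    finally show ?thesis .
  qed
  have g_int: "integrable N (case_prod g)"
  proof (rule integrableI_bounded)
    show "case_prod g \<in> borel_measurable N" unfolding N_def by measurable
    have "(\<integral>\<^sup>+p. ennreal (norm (case_prod g p)) \<partial>N) = (\<integral>\<^sup>+h. (\<integral>\<^sup>+x. ennreal (norm (g h x)) \<partial>lborel) \<partial>ball_measure r)"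
      unfolding N_def by (subst lborel.nn_integral_fst[symmetric]) simp_all
    then show "(\<integral>\<^sup>+p. ennreal (norm (case_prod g p)) \<partial>N) < \<infinity>" using nn by simp
  qed
  define g2 where "g2 h x = - g (- h) (x + h)" for h x
  have [measurable]: "case_prod g2 \<in> borel_measurable (borel \<Otimes>\<^sub>M borel)"
    unfolding g2_def g_def by measurable
  have g2_int: "integrable N (case_prod g2)"
  proof (rule integrableI_bounded)
    show "case_prod g2 \<in> borel_measurable N" unfolding N_def by measurable
    have "(\<integral>\<^sup>+p. ennreal (norm (case_prod g2 p)) \<partial>N) = (\<integral>\<^sup>+h. (\<integral>\<^sup>+x. ennreal (norm (g2 h x)) \<partial>lborel) \<partial>ball_measure r)"
      unfolding N_def by (subst lborel.nn_integral_fst[symmetric]) simp_all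
    also have "\<dots> = (\<integral>\<^sup>+h. (\<integral>\<^sup>+x. ennreal (norm (g (- h) x)) \<partial>lborel) \<partial>ball_measure r)"
      unfolding g2_def norm_minus_cancel
      by (intro nn_integral_cong nn_integral_lborel_shift[where f="\<lambda>x. ennreal (norm (g (- _) x))"]) measurable
    also have "\<dots> = (\<integral>\<^sup>+h. (\<integral>\<^sup>+x. ennreal (norm (g h x)) \<partial>lborel) \<partial>ball_measure r)"
      by (rule nn_integral_ball_measure_uminus[where f="\<lambda>h. \<integral>\<^sup>+x. ennreal (norm (g h x)) \<partial>lborel"]) measurable
    finally show "(\<integral>\<^sup>+p. ennreal (norm (case_prod g2 p)) \<partial>N) < \<infinity>" using nn by simp
  qed
  have "(\<integral>p. case_prod g2 p \<partial>N) = (\<integral>h. (\<integral>x. g2 h x \<partial>lborel) \<partial>ball_measure r)"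
    using g2_int unfolding N_def by (subst N.integral_fst'[symmetric]) simp_all
  also have "\<dots> = (\<integral>h. - (\<integral>x. g (- h) x \<partial>lborel) \<partial>ball_measure r)"
    unfolding g2_def by (simp add: integral_lborel_shift)
  also have "\<dots> = - (\<integral>h. (\<integral>x. g h x \<partial>lborel) \<partial>ball_measure r)"
    using integral_ball_measure_uminus[of "\<lambda>h. \<integral>x. g h x \<partial>lborel" r] by simp
  also have "(\<integral>h. (\<integral>x. g h x \<partial>lborel) \<partial>ball_measure r) = (\<integral>p. case_prod g p \<partial>N)"
    using g_int unfolding N_def by (subst N.integral_fst'[symmetric]) simp_all
  finally have sym: "(\<integral>p. case_prod g2 p \<partial>N) = - (\<integral>p. case_prod g p \<partial>N)" .
  \<comment> \<open>Integrating over \<open>h\<close> before \<open>x\<close> exposes the disc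
    average of the increment, which is \<open>- cut_kernel r\<close> times the area of the
    disc.\<close>
  have "(\<integral>p. case_prod g p \<partial>N) = (\<integral>x. (\<integral>h. g h x \<partial>ball_measure r) \<partial>lborel)"
    using N.integral_snd[of g] g_int unfolding N_def by simp
  also have "\<dots> = (\<integral>x. - (pi * r\<^sup>2) * (cut_kernel r x * cnj (inverse (x - z))) \<partial>lborel)"
  proof (rule Bochner_Integration.integral_cong)
    fix x :: complex
    have m: "(\<integral>h. indicator (ball (0::complex) r) h *\<^sub>R inverse x \<partial>lborel) = pi * r\<^sup>2 * inverse x"
      using r by (simp add: content_ball unit_ball_vol_2 scaleR_conv_of_real)
    have "(\<integral>h. g h x \<partial>ball_measure r) = (\<integral>h. kernel_increment h x \<partial>ball_measure r) * cnj (inverse (x - z))"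
      unfolding g_def by (rule integral_mult_left_zero)
    also have "(\<integral>h. kernel_increment h x \<partial>ball_measure r)
      = (\<integral>h. indicator (ball 0 r) h *\<^sub>R inverse (x + h) - indicator (ball 0 r) h *\<^sub>R inverse x \<partial>lborel)"
      by (simp add: integral_ball_measure kernel_increment_def scaleR_diff_right)
    also have "\<dots> = pi * (min r (norm x))\<^sup>2 * inverse x - pi * r\<^sup>2 * inverse x"
      using integrable_ball_inverse[OF r, of x] emeasure_lborel_ball_finite[of "0::complex" r]
      by (subst Bochner_Integration.integral_diff) (simp_all add: integral_ball_inverse[OF r] m)
    also have "\<dots> = - (pi * r\<^sup>2) * cut_kernel r x"
    proof (cases "norm x < r")
      case True
      have eq: "pi * (norm x)\<^sup>2 - pi * r\<^sup>2 = - (pi * r\<^sup>2) * (1 - (norm x / r)\<^sup>2)"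
        using r by (simp add: field_simps)
      have "pi * (min r (norm x))\<^sup>2 * inverse x - pi * r\<^sup>2 * inverse x
        = complex_of_real (pi * (norm x)\<^sup>2 - pi * r\<^sup>2) * inverse x"
        using True by (simp add: min_def left_diff_distrib)
      also have "\<dots> = complex_of_real (- (pi * r\<^sup>2) * (1 - (norm x / r)\<^sup>2)) * inverse x"
        by (simp only: eq)
      also have "\<dots> = - (pi * r\<^sup>2) * cut_kernel r x"
        using True by (simp add: cut_kernel_def scaleR_conv_of_real)
      finally show ?thesis .
    qed (simp add: cut_kernel_def min_def)
    finally show "(\<integral>h. g h x \<partial>ball_measure r) = - (pi * r\<^sup>2) * (cut_kernel r x * cnj (inverse (x - z)))"
      by (simp only: mult.assoc)
  qed simp
  also have "\<dots> = - (pi * r\<^sup>2) * (\<integral>x. cut_kernel r x * cnj (inverse (x - z)) \<partial>lborel)"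
    by (rule integral_mult_right_zero)
  finally have g_val: "(\<integral>p. case_prod g p \<partial>N) = - (pi * r\<^sup>2) * (\<integral>x. cut_kernel r x * cnj (inverse (x - z)) \<partial>lborel)" .
  have "kernel_increment h x * cnj (kernel_increment h (x - z)) = g2 h x - g h x" for h x
  proof -
    have "g2 h x = kernel_increment h x * cnj (inverse (x - z + h))"
      by (simp add: g2_def g_def kernel_increment_def algebra_simps del: complex_cnj_inverse)
    then show ?thesis
      by (simp only: g_def kernel_increment_def[of h "x - z"] complex_cnj_diff right_diff_distrib)
  qed
  then have split: "(\<lambda>(h, x). kernel_increment h x * cnj (kernel_increment h (x - z))) = (\<lambda>p. case_prod g2 p - case_prod g p)"
    by (simp add: fun_eq_iff)
  define T where "T = (\<integral>(h, x). kernel_increment h x * cnj (kernel_increment h (x - z)) \<partial>N)"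
  define F where "F = (\<integral>x. cut_kernel r x * cnj (inverse (x - z)) \<partial>lborel)"
  \<comment> \<open>Both halves contribute equally, whence \<open>2 * pi * r^2\<close>; a further
    \<open>2 * pi\<close> comes with the bound for \<open>F\<close>.\<close>
  have "T = (\<integral>p. case_prod g2 p \<partial>N) - (\<integral>p. case_prod g p \<partial>N)"
    unfolding T_def split by (rule Bochner_Integration.integral_diff[OF g2_int g_int])
  also have "\<dots> = complex_of_real (2 * pi * r\<^sup>2) * F"
    unfolding sym g_val F_def[symmetric] by simp
  finally have "norm T = 2 * pi * r\<^sup>2 * norm F"
    by (simp add: norm_mult norm_power)
  then have "ennreal (norm T) = ennreal (2 * pi * r\<^sup>2) * ennreal (norm F)"
    by (simp add: ennreal_mult)
  also have "\<dots> \<le> ennreal (2 * pi * r\<^sup>2) * (ennreal (2 * pi) * log_kernel r (norm z))"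
    unfolding F_def by (intro mult_left_mono norm_integral_cut_kernel_product r z) simp
  also have "\<dots> = ennreal (4 * pi\<^sup>2 * r\<^sup>2) * log_kernel r (norm z)"
    by (simp add: mult.assoc[symmetric] ennreal_mult[symmetric]) (simp add: power2_eq_square mult_ac)
  finally show ?thesis unfolding T_def .
qed

section \<open>The averaged energy of a measure\<close>

text \<open>The square of an integral is a double integral over \<nu> \<otimes> \<nu>. Exchanging it
  with the integral over \<open>N\<close> postpones absolute values until the latter has been
  evaluated, so its cancellation is kept. The hypothesis \<open>fin\<close> is the absolute
  integrability behind the exchange.\<close>

lemma nn_integral_norm_integral_square_le:
  fixes \<kappa> :: "'p \<Rightarrow> 'y \<Rightarrow> complex"
  assumes N: "sigma_finite_measure N" and \<nu>: "sigma_finite_measure \<nu>"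
    and \<kappa> [measurable]: "case_prod \<kappa> \<in> borel_measurable (N \<Otimes>\<^sub>M \<nu>)"
    and fin: "(\<integral>\<^sup>+y. (\<integral>\<^sup>+y'. (\<integral>\<^sup>+p. ennreal (norm (\<kappa> p y) * norm (\<kappa> p y')) \<partial>N) \<partial>\<nu>) \<partial>\<nu>) < \<infinity>"
  shows "(\<integral>\<^sup>+p. ennreal ((norm (\<integral>y. \<kappa> p y \<partial>\<nu>))\<^sup>2) \<partial>N)
    \<le> (\<integral>\<^sup>+y. (\<integral>\<^sup>+y'. ennreal (norm (\<integral>p. \<kappa> p y * cnj (\<kappa> p y') \<partial>N)) \<partial>\<nu>) \<partial>\<nu>)"
proof -
  interpret N: sigma_finite_measure N by fact
  interpret \<nu>: sigma_finite_measure \<nu> by fact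
  interpret Y: pair_sigma_finite \<nu> \<nu> ..
  interpret Q: pair_sigma_finite N "\<nu> \<Otimes>\<^sub>M \<nu>" ..
  define G where "G p = (\<lambda>(y, y'). \<kappa> p y * cnj (\<kappa> p y'))" for p
  have G_meas [measurable]: "case_prod G \<in> borel_measurable (N \<Otimes>\<^sub>M (\<nu> \<Otimes>\<^sub>M \<nu>))"
    unfolding G_def by measurable
  have norm_G: "norm (G p (y, y')) = norm (\<kappa> p y) * norm (\<kappa> p y')" for p y y'
    by (simp add: G_def norm_mult)
  have G_int: "integrable (N \<Otimes>\<^sub>M (\<nu> \<Otimes>\<^sub>M \<nu>)) (case_prod G)"
  proof (rule integrableI_bounded[OF G_meas])
    have "(\<integral>\<^sup>+q. ennreal (norm (case_prod G q)) \<partial>(N \<Otimes>\<^sub>M (\<nu> \<Otimes>\<^sub>M \<nu>)))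
      = (\<integral>\<^sup>+z. (\<integral>\<^sup>+p. ennreal (norm (G p z)) \<partial>N) \<partial>(\<nu> \<Otimes>\<^sub>M \<nu>))"
      by (subst Q.nn_integral_snd[symmetric]) simp_all
    also have "\<dots> = (\<integral>\<^sup>+y. (\<integral>\<^sup>+y'. (\<integral>\<^sup>+p. ennreal (norm (G p (y, y'))) \<partial>N) \<partial>\<nu>) \<partial>\<nu>)"
      by (subst \<nu>.nn_integral_fst[symmetric]) simp_all
    finally show "(\<integral>\<^sup>+q. ennreal (norm (case_prod G q)) \<partial>(N \<Otimes>\<^sub>M (\<nu> \<Otimes>\<^sub>M \<nu>))) < \<infinity>"
      using fin by (simp only: norm_G)
  qed
  have square: "complex_of_real ((norm (\<integral>y. \<kappa> p y \<partial>\<nu>))\<^sup>2) = (\<integral>z. G p z \<partial>(\<nu> \<Otimes>\<^sub>M \<nu>))"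
    if p: "p \<in> space N" and int: "integrable (\<nu> \<Otimes>\<^sub>M \<nu>) (G p)" for p
  proof -
    have [measurable]: "\<kappa> p \<in> borel_measurable \<nu>" using p by simp
    have "(\<integral>\<^sup>+z. ennreal (norm (G p z)) \<partial>(\<nu> \<Otimes>\<^sub>M \<nu>)) < \<infinity>"
      using int by (simp add: integrable_iff_bounded)
    also have "(\<integral>\<^sup>+z. ennreal (norm (G p z)) \<partial>(\<nu> \<Otimes>\<^sub>M \<nu>))
      = (\<integral>\<^sup>+y. (\<integral>\<^sup>+y'. ennreal (norm (\<kappa> p y)) * ennreal (norm (\<kappa> p y')) \<partial>\<nu>) \<partial>\<nu>)"
      using int by (subst \<nu>.nn_integral_fst[symmetric]) (auto simp: norm_G ennreal_mult)
    \<comment> \<open>The absolute double integral factors into a square, so its finiteness gives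
      integrability of \<open>\<kappa> p\<close>.\<close>
    also have "\<dots> = (\<integral>\<^sup>+y. ennreal (norm (\<kappa> p y)) \<partial>\<nu>) * (\<integral>\<^sup>+y. ennreal (norm (\<kappa> p y)) \<partial>\<nu>)"
      by (simp add: nn_integral_cmult nn_integral_multc)
    finally have "(\<integral>\<^sup>+y. ennreal (norm (\<kappa> p y)) \<partial>\<nu>) < \<infinity>"
      by (metis ennreal_top_mult infinity_ennreal_def mult_eq_0_iff less_irrefl top.not_eq_extremum ennreal_mult_eq_top_iff)
    then have \<kappa>_int: "integrable \<nu> (\<kappa> p)" by (intro integrableI_bounded) auto
    have "(\<integral>z. G p z \<partial>(\<nu> \<Otimes>\<^sub>M \<nu>)) = (\<integral>y. (\<integral>y'. G p (y, y') \<partial>\<nu>) \<partial>\<nu>)"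
      using Y.integral_fst'[OF int] by simp
    also have "\<dots> = (\<integral>y. \<kappa> p y * cnj (\<integral>y'. \<kappa> p y' \<partial>\<nu>) \<partial>\<nu>)"
      unfolding G_def prod.case by (intro Bochner_Integration.integral_cong) simp_all
    also have "\<dots> = (\<integral>y. \<kappa> p y \<partial>\<nu>) * cnj (\<integral>y'. \<kappa> p y' \<partial>\<nu>)" by (rule integral_mult_left_zero)
    also have "\<dots> = complex_of_real ((norm (\<integral>y. \<kappa> p y \<partial>\<nu>))\<^sup>2)"
      by (rule complex_norm_square[symmetric])
    finally show ?thesis by (rule sym)
  qed
  define S where "S p = (\<integral>z. G p z \<partial>(\<nu> \<Otimes>\<^sub>M \<nu>))" for p
  have S_int: "integrable N S" unfolding S_def by (rule Q.integrable_fst[OF G_int])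
  have S_sq: "AE p in N. complex_of_real ((norm (\<integral>y. \<kappa> p y \<partial>\<nu>))\<^sup>2) = S p"
    using Q.AE_integrable_fst[OF G_int] AE_space unfolding S_def
    by eventually_elim (simp only: square)
  have "(\<integral>\<^sup>+p. ennreal ((norm (\<integral>y. \<kappa> p y \<partial>\<nu>))\<^sup>2) \<partial>N) = (\<integral>\<^sup>+p. ennreal (Re (S p)) \<partial>N)"
  proof (rule nn_integral_cong_AE)
    show "AE p in N. ennreal ((norm (\<integral>y. \<kappa> p y \<partial>\<nu>))\<^sup>2) = ennreal (Re (S p))"
      using S_sq by eventually_elim (metis Re_complex_of_real)
  qed
  also have "\<dots> = ennreal (\<integral>p. Re (S p) \<partial>N)"
  proof (rule nn_integral_eq_integral)
    show "integrable N (\<lambda>p. Re (S p))" using S_int by simp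
    show "AE p in N. 0 \<le> Re (S p)"
      using S_sq by eventually_elim (metis Re_complex_of_real zero_le_power2)
  qed
  also have "\<dots> \<le> ennreal (norm (\<integral>p. S p \<partial>N))"
    using S_int complex_Re_le_cmod[of "\<integral>p. S p \<partial>N"] by (intro ennreal_leI) simp
  also have "(\<integral>p. S p \<partial>N) = (\<integral>z. (\<integral>p. G p z \<partial>N) \<partial>(\<nu> \<Otimes>\<^sub>M \<nu>))"
    unfolding S_def by (rule Q.Fubini_integral[OF G_int, symmetric])
  also have "ennreal (norm \<dots>) \<le> (\<integral>\<^sup>+z. ennreal (norm (\<integral>p. G p z \<partial>N)) \<partial>(\<nu> \<Otimes>\<^sub>M \<nu>))"
    by (intro integral_norm_bound_ennreal Q.integrable_snd[OF G_int])
  also have "\<dots> = (\<integral>\<^sup>+y. (\<integral>\<^sup>+y'. ennreal (norm (\<integral>p. G p (y, y') \<partial>N)) \<partial>\<nu>) \<partial>\<nu>)"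
    by (subst \<nu>.nn_integral_fst[symmetric]) simp_all
  finally show ?thesis by (simp add: G_def)
qed

text \<open>The primitive is \<open>C / (\<beta> - 1) * (- ln s) powr (1 - \<beta>)\<close>, with
  \<open>- ln s > 0\<close> because \<open>s < 1\<close>. It tends to 0 at 0 since
  \<open>1 - \<beta> < 0\<close>; here the factor \<open>1 / (\<beta> - 1)\<close> and the exponent
  of the final estimate arise.\<close>

lemma nn_integral_log_powr:
  assumes "0 < r" "r < 1" "1 < \<beta>" "0 \<le> C"
  shows "(\<integral>\<^sup>+s. indicator {0<..<r} s * ennreal (1 / s * (C * \<bar>ln s\<bar> powr (- \<beta>))) \<partial>lborel)
    = ennreal (C / (\<beta> - 1) * \<bar>ln r\<bar> powr (1 - \<beta>))"
proof -
  define f where "f s = 1 / s * (C * (- ln s) powr (- \<beta>))" for s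
  define F where "F s = C / (\<beta> - 1) * (- ln s) powr (1 - \<beta>)" for s
  have eq: "f s = 1 / s * (C * \<bar>ln s\<bar> powr (- \<beta>))" if "0 < s" "s < r" for s
    using that assms by (simp add: f_def abs_if)
  have F: "(F has_real_derivative f s) (at s)" if "0 < s" "s < r" for s
  proof -
    have "- ln s > 0" using that assms by simp
    then have "((\<lambda>s. (- ln s) powr (1 - \<beta>)) has_real_derivative
       (1 - \<beta>) * (- ln s) powr (1 - \<beta> - 1) * (- (1 / s))) (at s)"
      using that by (auto intro!: derivative_eq_intros)
    then have "(F has_real_derivative (C / (\<beta> - 1) * ((1 - \<beta>) * (- ln s) powr (1 - \<beta> - 1) * (- (1 / s))))) (at s)"
      unfolding F_def by (rule DERIV_cmult)
    moreover have "C / (\<beta> - 1) * ((1 - \<beta>) * (- ln s) powr (1 - \<beta> - 1) * (- (1 / s))) = f s"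
      using assms that by (simp add: f_def divide_simps) (simp add: algebra_simps)
    ultimately show ?thesis by simp
  qed
  have c: "isCont f s" if "0 < s" "s < r" for s
    unfolding f_def using that assms by (intro continuous_intros) auto
  have nonneg: "0 \<le> f s" if "0 < s" for s using that assms by (simp add: f_def)
  have lim0: "(F \<longlongrightarrow> 0) (at_right 0)"
  proof -
    have "filterlim (\<lambda>s::real. - ln s) at_top (at_right 0)"
      using ln_at_0 by (simp add: filterlim_uminus_at_top)
    then have "((\<lambda>s::real. (- ln s) powr (1 - \<beta>)) \<longlongrightarrow> 0) (at_right 0)"
      using assms by (intro tendsto_neg_powr) auto
    then show ?thesis unfolding F_def by (rule tendsto_mult_right_zero)
  qed
  have limr: "(F \<longlongrightarrow> F r) (at_left r)"
  proof -
    have "isCont F r" unfolding F_def using assms by (intro continuous_intros) auto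
    then show ?thesis using continuous_within filterlim_at_split isCont_def by blast
  qed
  have z: "ereal 0 < ereal r" using assms by simp
  have 1: "((F \<circ> real_of_ereal) \<longlongrightarrow> 0) (at_right (ereal 0))" "((F \<circ> real_of_ereal) \<longlongrightarrow> F r) (at_left (ereal r))"
    using lim0 limr by (simp_all only: ereal_tendsto_simps)
  have ae: "AE x in lborel. ereal 0 < ereal x \<longrightarrow> ereal x < ereal r \<longrightarrow> 0 \<le> f x"
    using nonneg by simp
  have int: "set_integrable lborel (einterval (ereal 0) (ereal r)) f" "(LBINT x=ereal 0..ereal r. f x) = F r - 0"
    by (rule interval_integral_FTC_nonneg[OF z _ _ ae 1]; use F c in simp)+
  have E: "einterval (ereal 0) (ereal r) = {0<..<r}" by (auto simp: einterval_def)
  have int': "integrable lborel (\<lambda>s. indicator {0<..<r} s *\<^sub>R f s)"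
    using int(1) by (simp add: set_integrable_def E)
  have val: "(\<integral>s. indicator {0<..<r} s *\<^sub>R f s \<partial>lborel) = F r"
    using int(2) assms by (simp add: interval_lebesgue_integral_def set_lebesgue_integral_def E)
  have "(\<integral>\<^sup>+s. indicator {0<..<r} s * ennreal (1 / s * (C * \<bar>ln s\<bar> powr (- \<beta>))) \<partial>lborel)
    = (\<integral>\<^sup>+s. ennreal (indicator {0<..<r} s *\<^sub>R f s) \<partial>lborel)"
    by (intro nn_integral_cong) (auto simp: eq split: split_indicator)
  also have "\<dots> = ennreal (F r)"
    using nn_integral_eq_integral[OF int'] nonneg val by (auto split: split_indicator)
  also have "F r = C / (\<beta> - 1) * \<bar>ln r\<bar> powr (1 - \<beta>)" using assms by (simp add: F_def abs_if)
  finally show ?thesis .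
qed

lemma pred_in_greaterThanLessThan [measurable (raw)]:
  fixes f g h :: "'a \<Rightarrow> real"
  assumes [measurable]: "f \<in> borel_measurable M" "g \<in> borel_measurable M" "h \<in> borel_measurable M"
  shows "Measurable.pred M (\<lambda>x. f x \<in> {g x<..<h x})"
  unfolding greaterThanLessThan_iff by measurable

text \<open>With \<open>log_kernel\<close> written as an integral over \<open>s\<close>, this is one
  application of Fubini. The integrand is infinite at \<open>y' = y\<close>, so finiteness also
  reflects that the decay rules out atoms of \<nu>.\<close>

lemma nn_integral_log_kernel_le:
  fixes \<nu> :: "complex measure"
  assumes \<nu>: "sigma_finite_measure \<nu>" and sets [measurable_cong]: "sets \<nu> = sets borel"
    and r: "0 < r" "r < 1/2" and C: "0 \<le> C" and \<beta>: "1 < \<beta>"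
    and decay: "\<And>s. s \<in> {0<..<1/2} \<Longrightarrow> emeasure \<nu> (cball y s) \<le> ennreal (C * \<bar>ln s\<bar> powr (- \<beta>))"
  shows "(\<integral>\<^sup>+y'. log_kernel r (norm (y' - y)) \<partial>\<nu>) \<le> ennreal (C / (\<beta> - 1) * \<bar>ln r\<bar> powr (1 - \<beta>))"
proof -
  interpret \<nu>: sigma_finite_measure \<nu> by fact
  interpret P: pair_sigma_finite lborel \<nu> ..
  have "(\<integral>\<^sup>+y'. log_kernel r (norm (y' - y)) \<partial>\<nu>)
     = (\<integral>\<^sup>+s. (\<integral>\<^sup>+y'. indicator {norm (y' - y)<..<r} s * ennreal (1 / s) \<partial>\<nu>) \<partial>lborel)"
    unfolding log_kernel_def by (rule P.Fubini') measurable
  also have "\<dots> \<le> (\<integral>\<^sup>+s. indicator {0<..<r} s * ennreal (1 / s * (C * \<bar>ln s\<bar> powr (- \<beta>))) \<partial>lborel)"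
  proof (intro nn_integral_mono)
    fix s :: real
    show "(\<integral>\<^sup>+y'. indicator {norm (y' - y)<..<r} s * ennreal (1 / s) \<partial>\<nu>)
      \<le> indicator {0<..<r} s * ennreal (1 / s * (C * \<bar>ln s\<bar> powr (- \<beta>)))"
    proof (cases "0 < s \<and> s < r")
      case True
      have "(\<integral>\<^sup>+y'. indicator {norm (y' - y)<..<r} s * ennreal (1 / s) \<partial>\<nu>)
        \<le> (\<integral>\<^sup>+y'. ennreal (1 / s) * indicator (cball y s) y' \<partial>\<nu>)"
        by (intro nn_integral_mono) (auto simp: dist_norm norm_minus_commute split: split_indicator)
      also have "\<dots> = ennreal (1 / s) * emeasure \<nu> (cball y s)"
        by (intro nn_integral_cmult_indicator) (simp add: sets)
      also have "\<dots> \<le> ennreal (1 / s) * ennreal (C * \<bar>ln s\<bar> powr (- \<beta>))"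
        using True r by (intro mult_left_mono decay) auto
      finally show ?thesis using True C by (simp add: ennreal_mult[symmetric])
    next
      case False
      have "indicator {norm (y' - y)<..<r} s * ennreal (1 / s) = 0" for y'
        using False norm_ge_zero[of "y' - y"] by (auto simp del: norm_ge_zero split: split_indicator)
      then show ?thesis by (simp only: nn_integral_const mult_zero_left zero_le)
    qed
  qed
  also have "\<dots> = ennreal (C / (\<beta> - 1) * \<bar>ln r\<bar> powr (1 - \<beta>))"
    using r by (intro nn_integral_log_powr \<beta> C) auto
  finally show ?thesis .
qed

text \<open>Moves a pair of points \<open>y\<close>, \<open>y'\<close> to \<open>0\<close>,
  \<open>y' - y\<close> by translating \<open>x\<close>, with the increment \<open>h\<close>
  untouched.\<close>

lemma distr_pair_shift:
  fixes c :: "'b::euclidean_space"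
  assumes "sigma_finite_measure M"
  shows "distr (M \<Otimes>\<^sub>M lborel) (M \<Otimes>\<^sub>M lborel) (\<lambda>(h, x). (h, x + c)) = M \<Otimes>\<^sub>M lborel"
proof (rule measure_eqI)
  fix A assume "A \<in> sets (distr (M \<Otimes>\<^sub>M lborel) (M \<Otimes>\<^sub>M lborel) (\<lambda>(h, x). (h, x + c)))"
  then have A [measurable]: "A \<in> sets (M \<Otimes>\<^sub>M lborel)" by simp
  have "emeasure (distr (M \<Otimes>\<^sub>M lborel) (M \<Otimes>\<^sub>M lborel) (\<lambda>(h, x). (h, x + c))) A
    = (\<integral>\<^sup>+p. indicator A p \<partial>distr (M \<Otimes>\<^sub>M lborel) (M \<Otimes>\<^sub>M lborel) (\<lambda>(h, x). (h, x + c)))"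
    by (rule nn_integral_indicator[symmetric]) (simp only: sets_distr A)
  also have "\<dots> = (\<integral>\<^sup>+p. indicator A (case p of (h, x) \<Rightarrow> (h, x + c)) \<partial>(M \<Otimes>\<^sub>M lborel))"
    by (rule nn_integral_distr) measurable
  also have "\<dots> = (\<integral>\<^sup>+h. (\<integral>\<^sup>+x. indicator A (h, x + c) \<partial>lborel) \<partial>M)"
    by (subst lborel.nn_integral_fst[symmetric]) simp_all
  also have "\<dots> = (\<integral>\<^sup>+h. (\<integral>\<^sup>+x. indicator A (h, x) \<partial>lborel) \<partial>M)"
  proof (rule nn_integral_cong)
    fix h assume [measurable]: "h \<in> space M"
    show "(\<integral>\<^sup>+x. indicator A (h, x + c) \<partial>lborel) = (\<integral>\<^sup>+x. indicator A (h, x) \<partial>lborel)"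
      by (rule nn_integral_lborel_shift) measurable
  qed
  also have "\<dots> = (\<integral>\<^sup>+p. indicator A p \<partial>(M \<Otimes>\<^sub>M lborel))"
    by (subst lborel.nn_integral_fst) simp_all
  also have "\<dots> = emeasure (M \<Otimes>\<^sub>M lborel) A" by (rule nn_integral_indicator[OF A])
  finally show "emeasure (distr (M \<Otimes>\<^sub>M lborel) (M \<Otimes>\<^sub>M lborel) (\<lambda>(h, x). (h, x + c))) A
    = emeasure (M \<Otimes>\<^sub>M lborel) A" .
qed simp

text \<open>Only the second increment is split into its two terms. Substituting \<open>x + h\<close>
  for \<open>x\<close> turns the term with pole at \<open>z - h\<close> into \<open>H (- h)\<close>,
  and the disc is symmetric, so both terms cost the same. The result supplies absolute
  integrability; its constant is absent from the final estimate.\<close>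

lemma kernel_increment_energy_bound:
  assumes r: "0 < r"
  obtains c where "0 \<le> c" "\<And>z. (\<integral>\<^sup>+h. (\<integral>\<^sup>+x. ennreal (norm (kernel_increment h x) * norm (kernel_increment h (x - z))) \<partial>lborel) \<partial>ball_measure r)
    \<le> ennreal c * (1 + log_kernel r (norm z))"
proof -
  obtain c where c: "0 \<le> c" and cb: "\<And>z. (\<integral>\<^sup>+h. indicator (ball 0 r) h *
      (\<integral>\<^sup>+x. ennreal (norm (kernel_increment h x)) * ennreal (1 / norm (x - z)) \<partial>lborel) \<partial>lborel)
       \<le> ennreal c * (1 + log_kernel r (norm z))"
    by (rule kernel_increment_product_bound[OF r]) (rule that)
  show thesis
  proof (rule that[of "c + c"])
    show "0 \<le> c + c" using c by simp
    fix z :: complex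
    define H where "H h = (\<integral>\<^sup>+x. ennreal (norm (kernel_increment h x)) * ennreal (1 / norm (x - z)) \<partial>lborel)" for h
    have [measurable]: "H \<in> borel_measurable borel" unfolding H_def by measurable
    have HB: "(\<integral>\<^sup>+h. H h \<partial>ball_measure r) \<le> ennreal c * (1 + log_kernel r (norm z))"
      using cb[of z] by (simp add: nn_integral_ball_measure H_def)
    have inner: "(\<integral>\<^sup>+x. ennreal (norm (kernel_increment h x) * norm (kernel_increment h (x - z))) \<partial>lborel) \<le> H (- h) + H h" for h
    proof -
      have "(\<integral>\<^sup>+x. ennreal (norm (kernel_increment h x) * norm (kernel_increment h (x - z))) \<partial>lborel)
        \<le> (\<integral>\<^sup>+x. ennreal (norm (kernel_increment (- h) (x + h))) * ennreal (1 / norm (x + h - z))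
          + ennreal (norm (kernel_increment h x)) * ennreal (1 / norm (x - z)) \<partial>lborel)"
      proof (intro nn_integral_mono)
        fix x
        have k: "norm (kernel_increment (- h) (x + h)) = norm (kernel_increment h x)"
          by (simp add: kernel_increment_def norm_minus_commute)
        have "norm (kernel_increment h (x - z)) \<le> 1 / norm (x + h - z) + 1 / norm (x - z)"
          using norm_triangle_ineq4[of "inverse (x + h - z)" "inverse (x - z)"]
          by (simp add: kernel_increment_def norm_inverse divide_inverse algebra_simps)
        then have "norm (kernel_increment h x) * norm (kernel_increment h (x - z))
          \<le> norm (kernel_increment h x) * (1 / norm (x + h - z) + 1 / norm (x - z))"
          by (rule mult_left_mono) simp
        then show "ennreal (norm (kernel_increment h x) * norm (kernel_increment h (x - z)))
          \<le> ennreal (norm (kernel_increment (- h) (x + h))) * ennreal (1 / norm (x + h - z))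
          + ennreal (norm (kernel_increment h x)) * ennreal (1 / norm (x - z))"
          unfolding k
          by (simp add: ennreal_mult[symmetric] ennreal_plus[symmetric] ennreal_leI distrib_left del: ennreal_plus)
      qed
      also have "\<dots> = (\<integral>\<^sup>+x. ennreal (norm (kernel_increment (- h) (x + h))) * ennreal (1 / norm (x + h - z)) \<partial>lborel) + H h"
        unfolding H_def by (rule nn_integral_add) measurable
      also have "(\<integral>\<^sup>+x. ennreal (norm (kernel_increment (- h) (x + h))) * ennreal (1 / norm (x + h - z)) \<partial>lborel) = H (- h)"
        unfolding H_def
        by (rule nn_integral_lborel_shift[where f="\<lambda>x. ennreal (norm (kernel_increment (- h) x)) * ennreal (1 / norm (x - z))"]) measurable
      finally show ?thesis .
    qed
    have "(\<integral>\<^sup>+h. (\<integral>\<^sup>+x. ennreal (norm (kernel_increment h x) * norm (kernel_increment h (x - z))) \<partial>lborel) \<partial>ball_measure r)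
      \<le> (\<integral>\<^sup>+h. H (- h) + H h \<partial>ball_measure r)"
      by (intro nn_integral_mono inner)
    also have "\<dots> = (\<integral>\<^sup>+h. H (- h) \<partial>ball_measure r) + (\<integral>\<^sup>+h. H h \<partial>ball_measure r)"
      by (rule nn_integral_add) measurable
    also have "(\<integral>\<^sup>+h. H (- h) \<partial>ball_measure r) = (\<integral>\<^sup>+h. H h \<partial>ball_measure r)"
      by (rule nn_integral_ball_measure_uminus) measurable
    also have "(\<integral>\<^sup>+h. H h \<partial>ball_measure r) + (\<integral>\<^sup>+h. H h \<partial>ball_measure r)
      \<le> ennreal c * (1 + log_kernel r (norm z)) + ennreal c * (1 + log_kernel r (norm z))"
      by (intro add_mono HB)
    also have "\<dots> = ennreal (c + c) * (1 + log_kernel r (norm z))"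
      by (simp only: ennreal_plus[OF c c] distrib_right)
    finally show "(\<integral>\<^sup>+h. (\<integral>\<^sup>+x. ennreal (norm (kernel_increment h x) * norm (kernel_increment h (x - z))) \<partial>lborel) \<partial>ball_measure r)
      \<le> ennreal (c + c) * (1 + log_kernel r (norm z))" .
  qed
qed

lemma measurable_log_kernel [measurable]: "log_kernel r \<in> borel_measurable borel"
  unfolding log_kernel_def by measurable

text \<open>Makes the energy bound trivial on the diagonal. The integral of \<open>1 / s\<close>
  from \<open>r * exp (- n)\<close> to \<open>r\<close> is \<open>n\<close>, for every
  \<open>n\<close>.\<close>

lemma log_kernel_zero:
  assumes r: "0 < r"
  shows "log_kernel r 0 = \<infinity>"
proof (rule ccontr)
  assume "log_kernel r 0 \<noteq> \<infinity>"
  have "ennreal (real n) \<le> log_kernel r 0" for n :: nat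
  proof -
    define a where "a = r * exp (- real n)"
    have a: "0 < a" "a \<le> r" using r by (simp_all add: a_def)
    have "ennreal (ln r - ln a) = (\<integral>\<^sup>+s. ennreal (1 / s) * indicator {a..r} s \<partial>lborel)"
      using a by (intro nn_integral_FTC_Icc[symmetric]) (auto intro!: derivative_eq_intros)
    also have "\<dots> \<le> log_kernel r 0"
      unfolding log_kernel_def using a AE_lborel_singleton[of r]
      by (intro nn_integral_mono_AE) (auto elim!: eventually_mono split: split_indicator)
    also have "ln r - ln a = real n" using r by (simp add: a_def ln_mult)
    finally show ?thesis .
  qed
  with \<open>log_kernel r 0 \<noteq> \<infinity>\<close> show False
    by (metis ennreal_of_nat_eq_real_of_nat infinity_ennreal_def ennreal_Ex_less_of_nat leD top.not_eq_extremum)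
qed

text \<open>The sign \<sigma> costs nothing in absolute value and translation leaves only
  \<open>y' - y\<close>, so the energy is controlled by the double \<nu>-integral of
  \<open>log_kernel r (norm (y' - y))\<close>. The integral over \<open>y'\<close> is at most
  \<open>L\<close> uniformly in \<open>y\<close>, and the one over \<open>y\<close> gives the total
  mass.\<close>

lemma averaged_increment_bound:
  fixes \<nu> :: "complex measure" and \<sigma> :: "complex \<Rightarrow> real"
  assumes \<nu>: "finite_measure \<nu>" and sets [measurable_cong]: "sets \<nu> = sets borel"
    and \<sigma> [measurable]: "\<sigma> \<in> borel_measurable borel" and \<sigma>1: "\<And>y. \<bar>\<sigma> y\<bar> \<le> 1"
    and r: "0 < r" "r < 1/2" and C: "0 \<le> C" and \<beta>: "1 < \<beta>"
    and decay: "\<And>s y. s \<in> {0<..<1/2} \<Longrightarrow> emeasure \<nu> (cball y s) \<le> ennreal (C * \<bar>ln s\<bar> powr (- \<beta>))"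
  shows "(\<integral>\<^sup>+h. (\<integral>\<^sup>+x. ennreal ((norm (\<integral>y. \<sigma> y *\<^sub>R kernel_increment h (x - y) \<partial>\<nu>))\<^sup>2) \<partial>lborel) \<partial>ball_measure r)
    \<le> ennreal (4 * pi\<^sup>2 * r\<^sup>2) * (ennreal (C / (\<beta> - 1) * \<bar>ln r\<bar> powr (1 - \<beta>)) * emeasure \<nu> UNIV)"
proof -
  interpret \<nu>: finite_measure \<nu> by fact
  interpret B: finite_measure "ball_measure r" by (rule finite_measure_ball_measure)
  interpret N: pair_sigma_finite "ball_measure r" "lborel :: complex measure" ..
  have space: "space \<nu> = UNIV" using sets_eq_imp_space_eq[OF sets] by simp
  define N where "N = ball_measure r \<Otimes>\<^sub>M (lborel :: complex measure)"
  define L where "L = ennreal (C / (\<beta> - 1) * \<bar>ln r\<bar> powr (1 - \<beta>))"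
  have L: "(\<integral>\<^sup>+y'. log_kernel r (norm (y' - y)) \<partial>\<nu>) \<le> L" for y
    unfolding L_def
    by (rule nn_integral_log_kernel_le[OF \<nu>.sigma_finite_measure_axioms sets r C \<beta> decay])
  define \<kappa> where "\<kappa> p y = (case p of (h, x) \<Rightarrow> complex_of_real (\<sigma> y) * kernel_increment h (x - y))" for p y
  have sN [measurable_cong]: "sets N = sets (borel \<Otimes>\<^sub>M borel)"
    unfolding N_def by (intro sets_pair_measure_cong) simp_all
  have \<kappa>_meas: "case_prod \<kappa> \<in> borel_measurable (N \<Otimes>\<^sub>M \<nu>)"
    unfolding \<kappa>_def by measurable
  define k where "k y = (\<lambda>(h, x). kernel_increment h (x - y))" for y
  have k_meas [measurable]: "k y \<in> borel_measurable N" for y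
    unfolding k_def by measurable
  have shift: "distr N N (\<lambda>(h, x). (h, x + c)) = N" for c
    unfolding N_def by (rule distr_pair_shift) (rule B.sigma_finite_measure_axioms)
  have shift_meas [measurable]: "(\<lambda>(h, x). (h, x + c)) \<in> measurable N N" for c
    unfolding N_def by measurable
  have k_shift: "k y (case p of (h, x) \<Rightarrow> (h, x + c)) = k (y - c) p" for y c p
    by (simp add: k_def algebra_simps split: prod.split)
  obtain c where c: "0 \<le> c" and cb: "\<And>z. (\<integral>\<^sup>+h. (\<integral>\<^sup>+x. ennreal (norm (kernel_increment h x) * norm (kernel_increment h (x - z))) \<partial>lborel) \<partial>ball_measure r)
    \<le> ennreal c * (1 + log_kernel r (norm z))"
    by (rule kernel_increment_energy_bound[OF r(1)]) (rule that)
  have abs_bound: "(\<integral>\<^sup>+p. ennreal (norm (\<kappa> p y) * norm (\<kappa> p y')) \<partial>N) \<le> ennreal c * (1 + log_kernel r (norm (y' - y)))" for y y'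
  proof -
    have "(\<integral>\<^sup>+p. ennreal (norm (\<kappa> p y) * norm (\<kappa> p y')) \<partial>N) \<le> (\<integral>\<^sup>+p. ennreal (norm (k y p) * norm (k y' p)) \<partial>N)"
    proof -
      have "norm (\<kappa> p y) \<le> norm (k y p)" for p y
        using mult_right_mono[OF \<sigma>1[of y], of "norm (kernel_increment (fst p) (snd p - y))"]
        by (simp add: \<kappa>_def k_def norm_mult case_prod_beta)
      then show ?thesis by (intro nn_integral_mono ennreal_leI mult_mono) auto
    qed
    also have "\<dots> = (\<integral>\<^sup>+p. ennreal (norm (k y p) * norm (k y' p)) \<partial>distr N N (\<lambda>(h, x). (h, x + y)))"
      by (simp only: shift)
    also have "\<dots> = (\<integral>\<^sup>+p. ennreal (norm (k y (case p of (h, x) \<Rightarrow> (h, x + y))) * norm (k y' (case p of (h, x) \<Rightarrow> (h, x + y)))) \<partial>N)"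
      by (rule nn_integral_distr) measurable
    also have "\<dots> = (\<integral>\<^sup>+p. ennreal (norm (k 0 p) * norm (k (y' - y) p)) \<partial>N)"
      by (simp only: k_shift diff_self)
    also have "\<dots> = (\<integral>\<^sup>+h. (\<integral>\<^sup>+x. ennreal (norm (kernel_increment h x) * norm (kernel_increment h (x - (y' - y)))) \<partial>lborel) \<partial>ball_measure r)"
      unfolding N_def k_def by (subst lborel.nn_integral_fst[symmetric]) (simp_all add: case_prod_beta)
    also have "\<dots> \<le> ennreal c * (1 + log_kernel r (norm (y' - y)))" by (rule cb)
    finally show ?thesis .
  qed
  have energy: "ennreal (norm (\<integral>p. \<kappa> p y * cnj (\<kappa> p y') \<partial>N)) \<le> ennreal (4 * pi\<^sup>2 * r\<^sup>2) * log_kernel r (norm (y' - y))" for y y'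
  proof (cases "y' = y")
    case True
    then show ?thesis using r by (simp add: log_kernel_zero ennreal_mult_top)
  next
    case False
    have "(\<integral>p. \<kappa> p y * cnj (\<kappa> p y') \<partial>N) = (\<integral>p. complex_of_real (\<sigma> y * \<sigma> y') * (k y p * cnj (k y' p)) \<partial>N)"
      by (intro Bochner_Integration.integral_cong) (simp_all add: \<kappa>_def k_def mult_ac split: prod.split)
    also have "\<dots> = complex_of_real (\<sigma> y * \<sigma> y') * (\<integral>p. k y p * cnj (k y' p) \<partial>N)"
      by (rule integral_mult_right_zero)
    finally have "norm (\<integral>p. \<kappa> p y * cnj (\<kappa> p y') \<partial>N) = \<bar>\<sigma> y * \<sigma> y'\<bar> * norm (\<integral>p. k y p * cnj (k y' p) \<partial>N)"
      by (simp only: norm_mult norm_of_real)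
    also have "\<dots> \<le> 1 * norm (\<integral>p. k y p * cnj (k y' p) \<partial>N)"
      using \<sigma>1[of y] \<sigma>1[of y'] by (intro mult_right_mono) (auto simp: abs_mult mult_le_one)
    also have "(\<integral>p. k y p * cnj (k y' p) \<partial>N) = (\<integral>p. k y p * cnj (k y' p) \<partial>distr N N (\<lambda>(h, x). (h, x + y)))"
      by (simp only: shift)
    also have "\<dots> = (\<integral>p. k y (case p of (h, x) \<Rightarrow> (h, x + y)) * cnj (k y' (case p of (h, x) \<Rightarrow> (h, x + y))) \<partial>N)"
      by (rule integral_distr) measurable
    also have "\<dots> = (\<integral>p. k 0 p * cnj (k (y' - y) p) \<partial>N)"
      by (simp only: k_shift diff_self)
    also have "\<dots> = (\<integral>(h, x). kernel_increment h x * cnj (kernel_increment h (x - (y' - y))) \<partial>N)"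
      by (simp only: k_def case_prod_beta' diff_zero)
    finally have "ennreal (norm (\<integral>p. \<kappa> p y * cnj (\<kappa> p y') \<partial>N))
      \<le> ennreal (norm (\<integral>(h, x). kernel_increment h x * cnj (kernel_increment h (x - (y' - y))) \<partial>N))"
      by (intro ennreal_leI) (simp only: mult_1_left)
    also have "\<dots> \<le> ennreal (4 * pi\<^sup>2 * r\<^sup>2) * log_kernel r (norm (y' - y))"
      unfolding N_def using False by (intro norm_integral_kernel_increment_product r(1)) simp
    finally show ?thesis .
  qed
  have "(\<integral>\<^sup>+h. (\<integral>\<^sup>+x. ennreal ((norm (\<integral>y. \<sigma> y *\<^sub>R kernel_increment h (x - y) \<partial>\<nu>))\<^sup>2) \<partial>lborel) \<partial>ball_measure r)
    = (\<integral>\<^sup>+p. ennreal ((norm (\<integral>y. \<kappa> p y \<partial>\<nu>))\<^sup>2) \<partial>N)"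
    unfolding N_def \<kappa>_def
    by (subst lborel.nn_integral_fst[symmetric]) (simp_all add: scaleR_conv_of_real case_prod_beta)
  also have "\<dots> \<le> (\<integral>\<^sup>+y. (\<integral>\<^sup>+y'. ennreal (norm (\<integral>p. \<kappa> p y * cnj (\<kappa> p y') \<partial>N)) \<partial>\<nu>) \<partial>\<nu>)"
  proof (rule nn_integral_norm_integral_square_le[OF _ \<nu>.sigma_finite_measure_axioms \<kappa>_meas])
    show "sigma_finite_measure N" unfolding N_def by (rule N.sigma_finite_measure_axioms)
    \<comment> \<open>The logarithm in the crude bound is integrable against \<nu> by the same
      \<open>L\<close> as in the sharp estimate, and \<nu> has finite mass.\<close>
    have "(\<integral>\<^sup>+y. (\<integral>\<^sup>+y'. (\<integral>\<^sup>+p. ennreal (norm (\<kappa> p y) * norm (\<kappa> p y')) \<partial>N) \<partial>\<nu>) \<partial>\<nu>)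
      \<le> (\<integral>\<^sup>+y. (\<integral>\<^sup>+y'. ennreal c * (1 + log_kernel r (norm (y' - y))) \<partial>\<nu>) \<partial>\<nu>)"
      by (intro nn_integral_mono abs_bound)
    also have "\<dots> \<le> (\<integral>\<^sup>+y. ennreal c * (emeasure \<nu> UNIV + L) \<partial>\<nu>)"
    proof (intro nn_integral_mono)
      fix y
      have "(\<integral>\<^sup>+y'. ennreal c * (1 + log_kernel r (norm (y' - y))) \<partial>\<nu>)
        = ennreal c * (emeasure \<nu> UNIV + (\<integral>\<^sup>+y'. log_kernel r (norm (y' - y)) \<partial>\<nu>))"
        by (subst nn_integral_cmult, measurable, subst nn_integral_add, measurable) (simp add: space)
      also have "\<dots> \<le> ennreal c * (emeasure \<nu> UNIV + L)"
        by (intro mult_left_mono add_left_mono L) simp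
      finally show "(\<integral>\<^sup>+y'. ennreal c * (1 + log_kernel r (norm (y' - y))) \<partial>\<nu>) \<le> ennreal c * (emeasure \<nu> UNIV + L)" .
    qed
    also have "\<dots> < \<infinity>"
    proof -
      have "emeasure \<nu> UNIV < top" by (simp add: less_top[symmetric])
      then show ?thesis unfolding L_def by (simp add: space ennreal_mult_less_top)
    qed
    finally show "(\<integral>\<^sup>+y. (\<integral>\<^sup>+y'. (\<integral>\<^sup>+p. ennreal (norm (\<kappa> p y) * norm (\<kappa> p y')) \<partial>N) \<partial>\<nu>) \<partial>\<nu>) < \<infinity>" .
  qed
  also have "\<dots> \<le> (\<integral>\<^sup>+y. (\<integral>\<^sup>+y'. ennreal (4 * pi\<^sup>2 * r\<^sup>2) * log_kernel r (norm (y' - y)) \<partial>\<nu>) \<partial>\<nu>)"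
    by (intro nn_integral_mono energy)
  also have "\<dots> \<le> (\<integral>\<^sup>+y. ennreal (4 * pi\<^sup>2 * r\<^sup>2) * L \<partial>\<nu>)"
  proof (intro nn_integral_mono)
    fix y
    have "(\<integral>\<^sup>+y'. ennreal (4 * pi\<^sup>2 * r\<^sup>2) * log_kernel r (norm (y' - y)) \<partial>\<nu>)
      = ennreal (4 * pi\<^sup>2 * r\<^sup>2) * (\<integral>\<^sup>+y'. log_kernel r (norm (y' - y)) \<partial>\<nu>)"
      by (rule nn_integral_cmult) measurable
    also have "\<dots> \<le> ennreal (4 * pi\<^sup>2 * r\<^sup>2) * L" by (intro mult_left_mono L) simp
    finally show "(\<integral>\<^sup>+y'. ennreal (4 * pi\<^sup>2 * r\<^sup>2) * log_kernel r (norm (y' - y)) \<partial>\<nu>) \<le> ennreal (4 * pi\<^sup>2 * r\<^sup>2) * L" .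
  qed
  also have "\<dots> = ennreal (4 * pi\<^sup>2 * r\<^sup>2) * (L * emeasure \<nu> UNIV)"
    by (simp add: space mult.assoc)
  finally show ?thesis unfolding L_def .
qed

section \<open>Velocity fields in the plane\<close>

lemma integral_density_indicator:
  fixes f :: "'a \<Rightarrow> 'b::{banach, second_countable_topology}"
  assumes "P \<in> sets M" "f \<in> borel_measurable M"
  shows "(\<integral>y. f y \<partial>density M (indicator P)) = (\<integral>y. indicator P y *\<^sub>R f y \<partial>M)"
proof -
  have "density M (indicator P) = density M (\<lambda>y. ennreal (indicator P y))" by (simp add: ennreal_indicator)
  then show ?thesis using assms by (simp add: integral_density)
qed

text \<open>The conjugation makes this map linear over the reals only, which is enough to pull it
  out of Bochner integrals. It multiplies all lengths by \<open>1 / (2 * pi)\<close>.\<close>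

definition complex_velocity :: "complex \<Rightarrow> real^2" where
  "complex_velocity w = (1 / (2 * pi)) *\<^sub>R complex_vec (\<i> * cnj w)"

lemma bounded_linear_complex_velocity: "bounded_linear complex_velocity"
proof -
  have "linear complex_velocity"
    by (rule linearI)
      (simp_all add: complex_velocity_def algebra_simps linear_add[OF linear_complex_vec] linear_scale[OF linear_complex_vec])
  then show ?thesis by (simp add: linear_conv_bounded_linear)
qed

lemma norm_complex_velocity: "norm (complex_velocity w) = norm w / (2 * pi)"
  by (simp add: complex_velocity_def norm_mult)

lemma biot_savart_kernel_complex: "biot_savart_kernel v = complex_velocity (inverse (vec_complex v))"
proof -
  have n: "(norm v)\<^sup>2 = (v $ 1)\<^sup>2 + (v $ 2)\<^sup>2"
    by (simp add: norm_vec_def L2_set_def sum_2)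
  show ?thesis
    unfolding biot_savart_kernel_def complex_velocity_def perp_def n
    by (simp add: vec_complex_def complex_vec_def vec_eq_iff forall_2) (simp add: divide_inverse_commute)
qed

text \<open>Local integrability of \<open>1 / norm\<close>, uniform in the position of the pole,
  gives the potential a finite integral over every disc. Almost everywhere the velocity is therefore
  an absolutely convergent integral.\<close>

lemma AE_potential_finite:
  fixes \<nu> :: "complex measure"
  assumes \<nu>: "finite_measure \<nu>" and sets [measurable_cong]: "sets \<nu> = sets borel"
  shows "AE x in lborel. (\<integral>\<^sup>+y. ennreal (1 / norm (x - y)) \<partial>\<nu>) < \<infinity>"
proof -
  interpret \<nu>: finite_measure \<nu> by fact
  interpret P: pair_sigma_finite "lborel :: complex measure" \<nu> ..
  have "AE x in lborel. indicator (ball 0 (real n)) x * (\<integral>\<^sup>+y. ennreal (1 / norm (x - y)) \<partial>\<nu>) \<noteq> \<infinity>" for n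
  proof (rule nn_integral_PInf_AE)
    have "(\<integral>\<^sup>+x. indicator (ball 0 (real n)) x * (\<integral>\<^sup>+y. ennreal (1 / norm (x - y)) \<partial>\<nu>) \<partial>lborel)
      = (\<integral>\<^sup>+x. (\<integral>\<^sup>+y. indicator (ball 0 (real n)) x * ennreal (1 / norm (x - y)) \<partial>\<nu>) \<partial>lborel)"
      by (intro nn_integral_cong nn_integral_cmult[symmetric]) measurable
    also have "\<dots> = (\<integral>\<^sup>+y. (\<integral>\<^sup>+x. indicator (ball 0 (real n)) x * ennreal (1 / norm (x - y)) \<partial>lborel) \<partial>\<nu>)"
      by (rule P.Fubini'[symmetric]) measurable
    also have "\<dots> \<le> (\<integral>\<^sup>+y. ennreal (2 * pi + pi * (real n)\<^sup>2) \<partial>\<nu>)"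
      by (intro nn_integral_mono nn_integral_inverse_norm_shifted_ball) simp
    also have "\<dots> < \<infinity>"
    proof -
      have "emeasure \<nu> (space \<nu>) < top" by (simp add: less_top[symmetric])
      then show ?thesis by (simp add: ennreal_mult_less_top del: ennreal_plus)
    qed
    finally show "(\<integral>\<^sup>+x. indicator (ball 0 (real n)) x * (\<integral>\<^sup>+y. ennreal (1 / norm (x - y)) \<partial>\<nu>) \<partial>lborel) \<noteq> \<infinity>"
      by simp
  qed measurable
  then have "AE x in lborel. \<forall>n. indicator (ball 0 (real n)) x * (\<integral>\<^sup>+y. ennreal (1 / norm (x - y)) \<partial>\<nu>) \<noteq> \<infinity>"
    by (simp add: AE_all_countable)
  then show ?thesis
  proof eventually_elim
    case (elim x)
    obtain n where "norm x < real n" using reals_Archimedean2 by blast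
    then show ?case using elim[rule_format, of n] by (simp add: less_top)
  qed
qed

text \<open>As \<open>P\<close> is an arbitrary predicate, the argument passes through a Borel null
  set containing its exceptional points.\<close>

lemma AE_lborel_shift:
  fixes c :: "'a::euclidean_space"
  assumes "AE x in lborel. P x"
  shows "AE x in lborel. P (x + c)"
proof -
  obtain S where S: "S \<in> null_sets lborel" "{x. \<not> P x} \<subseteq> S"
    using assms by (auto simp: eventually_ae_filter)
  have [measurable]: "S \<in> sets borel" using S by auto
  have "AE x in lborel. x \<notin> S" using S(1) by (rule AE_not_in)
  then have "AE x in distr lborel borel ((+) c). x \<notin> S" unfolding lborel_distr_plus .
  then have "AE x in lborel. c + x \<notin> S" by (subst (asm) AE_distr_iff) auto
  then show ?thesis using S(2) by (auto elim!: eventually_mono simp: add.commute)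
qed

lemma AE_lborel_vec_complex:
  assumes "AE x in lborel. P x"
  shows "AE v in lborel. P (vec_complex v)"
proof -
  obtain S where S: "S \<in> null_sets lborel" "{x. \<not> P x} \<subseteq> S"
    using assms by (auto simp: eventually_ae_filter)
  have [measurable]: "S \<in> sets borel" using S by auto
  have "AE x in lborel. x \<notin> S" using S(1) by (rule AE_not_in)
  then have "AE x in distr lborel borel vec_complex. x \<notin> S" unfolding distr_vec_complex .
  then have "AE v in lborel. vec_complex v \<notin> S" by (subst (asm) AE_distr_iff) auto
  then show ?thesis using S(2) by (auto elim!: eventually_mono)
qed

lemma nn_integral_vec_complex:
  assumes [measurable]: "f \<in> borel_measurable borel"
  shows "(\<integral>\<^sup>+v. f (vec_complex v) \<partial>lborel) = (\<integral>\<^sup>+x. f x \<partial>lborel)"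
proof -
  have "(\<integral>\<^sup>+x. f x \<partial>distr lborel borel vec_complex) = (\<integral>\<^sup>+v. f (vec_complex v) \<partial>lborel)"
    by (rule nn_integral_distr) measurable
  then show ?thesis by (simp add: distr_vec_complex)
qed

theorem corollary2p14:
  fixes \<omega> :: "(real^2) set \<Rightarrow> real" and u :: "real^2 \<Rightarrow> real^2" and C \<beta> :: real
  assumes "finite_signed_measure \<omega>"
    and "H_minus1_loc (signed_integral \<omega>)"
    and "u = velocity \<omega>"
    and "C > 0" and "\<beta> > 1"
    and "\<And>r. r \<in> {0<..<1/2} \<Longrightarrow> vorticity_maximal r \<omega> \<le> ennreal (C * \<bar>ln r\<bar> powr (- \<beta>))"
  shows "\<forall>r\<in>{0<..<1/2}.
    (\<integral>\<^sup>+h\<in>ball 0 r. (\<integral>\<^sup>+x. ennreal ((norm (u (x + h) - u x))\<^sup>2) \<partial>lborel) \<partial>lborel)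
        / emeasure lborel (ball (0::real^2) r)
      \<le> ennreal (C / (\<beta> - 1)) * norm_M \<omega> * ennreal (\<bar>ln r\<bar> powr (1 - \<beta>))"
proof
  fix r :: real assume "r \<in> {0<..<1/2}"
  then have r: "0 < r" "r < 1/2" by auto
  obtain \<mu> P where \<mu>: "finite_measure \<mu>" and sets_\<mu> [measurable_cong]: "sets \<mu> = sets borel"
    and P [measurable]: "P \<in> sets borel"
    and var: "\<And>A. A \<in> sets borel \<Longrightarrow> emeasure \<mu> A = variation \<omega> A"
    and parts: "pos_part \<omega> = density \<mu> (indicator P)" "neg_part \<omega> = density \<mu> (indicator (- P))"
    using Jordan_decomposition[OF assms(1)] by blast
  interpret \<mu>: finite_measure \<mu> by fact
  define \<nu> where "\<nu> = distr \<mu> borel vec_complex"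
  have [measurable]: "vec_complex \<in> measurable \<mu> borel" by (simp add: measurable_cong_sets[OF sets_\<mu> refl])
  have sets_\<nu> [measurable_cong]: "sets \<nu> = sets borel" by (simp add: \<nu>_def)
  have \<nu>: "finite_measure \<nu>" unfolding \<nu>_def by (rule \<mu>.finite_measure_distr) measurable
  have \<nu>_UNIV: "emeasure \<nu> UNIV = norm_M \<omega>"
    using var[of UNIV] sets_eq_imp_space_eq[OF sets_\<mu>] by (simp add: \<nu>_def emeasure_distr norm_M_def)
  \<comment> \<open>The density of \<omega> with respect to its variation, carried to the complex
    plane: 1 on the Hahn set and -1 off it.\<close>
  define \<sigma> where "\<sigma> z = (indicator P (complex_vec z) - indicator (- P) (complex_vec z) :: real)" for z
  have [measurable]: "\<sigma> \<in> borel_measurable borel" unfolding \<sigma>_def by measurable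
  have \<sigma>1: "\<bar>\<sigma> z\<bar> \<le> 1" for z by (simp add: \<sigma>_def indicator_def)
  have decay: "emeasure \<nu> (cball y s) \<le> ennreal (C * \<bar>ln s\<bar> powr (- \<beta>))" if "s \<in> {0<..<1/2}" for s y
  proof -
    have "vec_complex -` cball y s = cball (complex_vec y) s"
    proof (rule set_eqI)
      show "v \<in> vec_complex -` cball y s \<longleftrightarrow> v \<in> cball (complex_vec y) s" for v
        using norm_vec_complex[of "complex_vec y - v"] by (simp add: dist_norm vec_complex_diff)
    qed
    then have "emeasure \<nu> (cball y s) = variation \<omega> (cball (complex_vec y) s)"
      using var[of "cball (complex_vec y) s"] sets_eq_imp_space_eq[OF sets_\<mu>] by (simp add: \<nu>_def emeasure_distr)
    also have "\<dots> \<le> vorticity_maximal s \<omega>" unfolding vorticity_maximal_def by (rule SUP_upper) simp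
    also have "\<dots> \<le> ennreal (C * \<bar>ln s\<bar> powr (- \<beta>))" using that by (rule assms(6))
    finally show ?thesis .
  qed
  define pot where "pot x = (\<integral>\<^sup>+y. ennreal (1 / norm (x - y)) \<partial>\<nu>)" for x
  define \<Phi> where "\<Phi> x = (\<integral>y. \<sigma> y *\<^sub>R inverse (x - y) \<partial>\<nu>)" for x
  have int_\<nu>: "integrable \<nu> (\<lambda>y. \<sigma> y *\<^sub>R inverse (x - y))" "integrable \<nu> (\<lambda>y. inverse (x - y))" if "pot x < \<infinity>" for x
  proof -
    show "integrable \<nu> (\<lambda>y. inverse (x - y))"
      using that by (intro integrableI_bounded) (simp_all add: pot_def norm_inverse divide_inverse)
    then show "integrable \<nu> (\<lambda>y. \<sigma> y *\<^sub>R inverse (x - y))"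
    proof (rule Bochner_Integration.integrable_bound)
      show "AE y in \<nu>. norm (\<sigma> y *\<^sub>R inverse (x - y)) \<le> norm (inverse (x - y))"
        using mult_right_mono[OF \<sigma>1 norm_ge_zero] by (intro always_eventually allI) simp
    qed measurable
  qed
  \<comment> \<open>Where the potential is infinite, a Bochner integral may fall back on 0 and the
    identity may fail; such points form a null set.\<close>
  have vel: "u v = complex_velocity (\<Phi> (vec_complex v))" if fin: "pot (vec_complex v) < \<infinity>" for v
  proof -
    define k where "k w = complex_velocity (inverse (vec_complex v - vec_complex w))" for w
    have cv [measurable]: "complex_velocity \<in> borel_measurable borel"
      by (intro borel_measurable_continuous_onI linear_continuous_on bounded_linear_complex_velocity)
    have [measurable]: "k \<in> borel_measurable borel" unfolding k_def by measurable
    have k\<mu> [measurable]: "k \<in> borel_measurable \<mu>" by measurable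
    have k_int: "integrable \<mu> k"
    proof -
      have "integrable \<mu> (\<lambda>w. inverse (vec_complex v - vec_complex w))"
        using int_\<nu>(2)[OF fin] unfolding \<nu>_def by (subst (asm) integrable_distr_eq) simp_all
      then show ?thesis unfolding k_def by (rule integrable_bounded_linear[OF bounded_linear_complex_velocity])
    qed
    have ind_int: "integrable \<mu> (\<lambda>w. indicator Q w *\<^sub>R k w)" if "Q \<in> sets borel" for Q
      using that by (intro integrable_mult_indicator k_int) (simp add: sets_\<mu>)
    have "u v = (\<integral>w. indicator P w *\<^sub>R k w \<partial>\<mu>) - (\<integral>w. indicator (- P) w *\<^sub>R k w \<partial>\<mu>)"
      unfolding assms(3) velocity_def signed_integral_def parts
      by (subst (1 2) integral_density_indicator)
        (simp_all add: sets_\<mu> biot_savart_kernel_complex vec_complex_diff k_def[symmetric])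
    also have "\<dots> = (\<integral>w. indicator P w *\<^sub>R k w - indicator (- P) w *\<^sub>R k w \<partial>\<mu>)"
      by (intro Bochner_Integration.integral_diff[symmetric] ind_int) auto
    also have "\<dots> = (\<integral>w. complex_velocity (\<sigma> (vec_complex w) *\<^sub>R inverse (vec_complex v - vec_complex w)) \<partial>\<mu>)"
      by (intro Bochner_Integration.integral_cong)
        (simp_all add: k_def \<sigma>_def scaleR_left_diff_distrib linear_scale[OF bounded_linear.linear[OF bounded_linear_complex_velocity]] linear_diff[OF bounded_linear.linear[OF bounded_linear_complex_velocity]])
    also have "\<dots> = (\<integral>z. complex_velocity (\<sigma> z *\<^sub>R inverse (vec_complex v - z)) \<partial>\<nu>)"
      unfolding \<nu>_def by (rule integral_distr[symmetric]) measurable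
    also have "\<dots> = complex_velocity (\<Phi> (vec_complex v))"
      unfolding \<Phi>_def by (rule integral_bounded_linear[OF bounded_linear_complex_velocity int_\<nu>(1)[OF fin]])
    finally show ?thesis .
  qed
  define \<Psi> where "\<Psi> h x = (\<integral>y. \<sigma> y *\<^sub>R kernel_increment h (x - y) \<partial>\<nu>)" for h x
  interpret \<nu>: finite_measure \<nu> by fact
  have \<Psi>_meas [measurable]: "case_prod \<Psi> \<in> borel_measurable (borel \<Otimes>\<^sub>M borel)"
    unfolding \<Psi>_def by measurable
  \<comment> \<open>For fixed \<open>h\<close>, both \<open>x\<close> and \<open>x + h\<close> avoid
    the exceptional points almost surely; the null set may depend on \<open>h\<close>, as
    \<open>x\<close> is the inner variable. The constant is the square of the factor
    \<open>1 / (2 * pi)\<close> in \<open>complex_velocity\<close>.\<close>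
  have increments: "(\<integral>\<^sup>+x. ennreal ((norm (u (x + h) - u x))\<^sup>2) \<partial>lborel)
    = ennreal (1 / (4 * pi\<^sup>2)) * (\<integral>\<^sup>+x. ennreal ((norm (\<Psi> (vec_complex h) x))\<^sup>2) \<partial>lborel)" for h
  proof -
    have "AE x in lborel. pot x < \<infinity>" unfolding pot_def by (rule AE_potential_finite[OF \<nu> sets_\<nu>])
    then have 1: "AE x in lborel. pot (vec_complex x) < \<infinity>" by (rule AE_lborel_vec_complex)
    from AE_lborel_shift[OF 1, of h] 1
    have ae: "AE x in lborel. pot (vec_complex x) < \<infinity> \<and> pot (vec_complex (x + h)) < \<infinity>"
      by eventually_elim (rule conjI)
    have "(\<integral>\<^sup>+x. ennreal ((norm (u (x + h) - u x))\<^sup>2) \<partial>lborel)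
      = (\<integral>\<^sup>+x. ennreal (1 / (4 * pi\<^sup>2)) * ennreal ((norm (\<Psi> (vec_complex h) (vec_complex x)))\<^sup>2) \<partial>lborel)"
    proof (rule nn_integral_cong_AE)
      show "AE x in lborel. ennreal ((norm (u (x + h) - u x))\<^sup>2)
        = ennreal (1 / (4 * pi\<^sup>2)) * ennreal ((norm (\<Psi> (vec_complex h) (vec_complex x)))\<^sup>2)"
        using ae
      proof eventually_elim
        case (elim x)
        have "\<Psi> (vec_complex h) (vec_complex x) = (\<integral>y. \<sigma> y *\<^sub>R inverse (vec_complex (x + h) - y) - \<sigma> y *\<^sub>R inverse (vec_complex x - y) \<partial>\<nu>)"
          unfolding \<Psi>_def
          by (intro Bochner_Integration.integral_cong)
            (simp_all add: kernel_increment_def vec_complex_add scaleR_right_diff_distrib algebra_simps)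
        also have "\<dots> = \<Phi> (vec_complex (x + h)) - \<Phi> (vec_complex x)"
          unfolding \<Phi>_def using elim by (intro Bochner_Integration.integral_diff int_\<nu>) auto
        finally have "u (x + h) - u x = complex_velocity (\<Psi> (vec_complex h) (vec_complex x))"
          using elim by (simp add: vel linear_diff[OF bounded_linear.linear[OF bounded_linear_complex_velocity]])
        then show ?case
          by (simp add: norm_complex_velocity power_divide power_mult_distrib ennreal_mult[symmetric])
      qed
    qed
    also have "\<dots> = (\<integral>\<^sup>+x. ennreal (1 / (4 * pi\<^sup>2)) * ennreal ((norm (\<Psi> (vec_complex h) x))\<^sup>2) \<partial>lborel)"
      by (rule nn_integral_vec_complex) measurable
    also have "\<dots> = ennreal (1 / (4 * pi\<^sup>2)) * (\<integral>\<^sup>+x. ennreal ((norm (\<Psi> (vec_complex h) x))\<^sup>2) \<partial>lborel)"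
      by (rule nn_integral_cmult) measurable
    finally show ?thesis .
  qed
  define D where "D h = (\<integral>\<^sup>+x. ennreal ((norm (\<Psi> h x))\<^sup>2) \<partial>lborel)" for h
  have [measurable]: "D \<in> borel_measurable borel" unfolding D_def by measurable
  define R where "R = ennreal (C / (\<beta> - 1) * \<bar>ln r\<bar> powr (1 - \<beta>)) * norm_M \<omega>"
  have "(\<integral>\<^sup>+h\<in>ball 0 r. (\<integral>\<^sup>+x. ennreal ((norm (u (x + h) - u x))\<^sup>2) \<partial>lborel) \<partial>lborel)
    = (\<integral>\<^sup>+h. ennreal (1 / (4 * pi\<^sup>2)) * (indicator (ball 0 r) (vec_complex h) * D (vec_complex h)) \<partial>lborel)"
    unfolding increments D_def[symmetric]
    by (intro nn_integral_cong) (auto split: split_indicator)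
  also have "\<dots> = (\<integral>\<^sup>+h. ennreal (1 / (4 * pi\<^sup>2)) * (indicator (ball 0 r) h * D h) \<partial>lborel)"
    by (rule nn_integral_vec_complex) measurable
  also have "\<dots> = ennreal (1 / (4 * pi\<^sup>2)) * (\<integral>\<^sup>+h. D h \<partial>ball_measure r)"
    by (simp add: nn_integral_cmult nn_integral_ball_measure)
  also have "\<dots> \<le> ennreal (1 / (4 * pi\<^sup>2)) * (ennreal (4 * pi\<^sup>2 * r\<^sup>2) * R)"
    unfolding D_def \<Psi>_def R_def \<nu>_UNIV[symmetric]
    using assms(4) by (intro mult_left_mono averaged_increment_bound[OF \<nu> sets_\<nu> _ \<sigma>1 r _ assms(5) decay]) auto
  also have "\<dots> = ennreal (r\<^sup>2) * R"
    by (simp add: mult.assoc[symmetric] ennreal_mult[symmetric])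
  \<comment> \<open>Using \<open>1 \<le> pi\<close> gives up the spare factor \<open>1 / pi\<close>
    and makes the area of the disc appear.\<close>
  also have "\<dots> \<le> ennreal (pi * r\<^sup>2) * R"
    using pi_gt3 mult_right_mono[of 1 pi "r\<^sup>2"] by (intro mult_right_mono ennreal_leI) auto
  finally have "(\<integral>\<^sup>+h\<in>ball 0 r. (\<integral>\<^sup>+x. ennreal ((norm (u (x + h) - u x))\<^sup>2) \<partial>lborel) \<partial>lborel)
    \<le> emeasure lborel (ball (0::real^2) r) * R"
    using r by (simp add: emeasure_ball unit_ball_vol_2)
  then have "(\<integral>\<^sup>+h\<in>ball 0 r. (\<integral>\<^sup>+x. ennreal ((norm (u (x + h) - u x))\<^sup>2) \<partial>lborel) \<partial>lborel)
        / emeasure lborel (ball (0::real^2) r) \<le> R"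
    using r by (intro divide_le_posI_ennreal) (simp_all add: emeasure_ball unit_ball_vol_2)
  also have "R = ennreal (C / (\<beta> - 1)) * norm_M \<omega> * ennreal (\<bar>ln r\<bar> powr (1 - \<beta>))"
    unfolding R_def using assms(4,5) by (subst ennreal_mult) (auto simp: mult_ac)
  finally show "(\<integral>\<^sup>+h\<in>ball 0 r. (\<integral>\<^sup>+x. ennreal ((norm (u (x + h) - u x))\<^sup>2) \<partial>lborel) \<partial>lborel)
        / emeasure lborel (ball (0::real^2) r)
      \<le> ennreal (C / (\<beta> - 1)) * norm_M \<omega> * ennreal (\<bar>ln r\<bar> powr (1 - \<beta>))" .
qed

end
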